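(* Let $f,g,F=f+g$ and $\mathcal O$ be as in the context, and let $\{(x^k,y^k)\}_{k\in\mathbb N}$ be a sequence generated by the line-search based variable metric inexact proximal gradient (VMiPG) method described in the context. Suppose that $\{x^k\}_{k\in\mathbb N}$ is bounded, that there is a constant $\overline\mu>0$ such that $\|\mathcal G_k\|\le\overline\mu$ for all $k\in\mathbb N$, and that there is $\varepsilon>0$ such that $\bigcup_{x\in S^*}\mathbb B(x,\varepsilon)\subset\mathcal O$ and $$L:=\max_{x\in\bigcup_{u\in S^*}\mathbb B(u,\varepsilon)}{\rm lip}\nabla f(x)<\overline\mu .$$ If $F$ is a KL function of exponent $\theta\in[1/2,1)$, then there exist $\varrho\in(0,1)$ and $c_1>0$ such that for all sufficiently large $k$, $$\|x^k-\overline x\|\le\begin{cases}c_1\varrho^k&\text{if }\theta=1/2,\\ c_1k^{\frac{1-\theta}{1-2\theta}}&\text{if }\theta\in(\tfrac12,1),\end{cases}$$ where $\overline x\in S^*$ is the limit of the sequence $\{x^k\}_{k\in\mathbb N}$.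
   Context: **Problem.** $\mathbb X$ is a finite-dimensional real vector space with inner product $\langle\cdot,\cdot\rangle$ and induced norm $\|\cdot\|$; $\overline{\mathbb R}=(-\infty,\infty]$; $\mathcal I$ is the identity on $\mathbb X$; $\mathbb B(x,\delta)$ is the closed ball; for a linear operator, $\|\cdot\|$ is the spectral norm; $\mathcal Q\succeq\mathcal Q'$ means that $\mathcal Q-\mathcal Q'$ is self-adjoint and positive semidefinite. The functions $f,g:\mathbb X\to\overline{\mathbb R}$ are proper, $F:=f+g$, and: (i) $g$ is lower semicontinuous (lsc), convex, and continuous relative to its domain ${\rm dom}\,g$; (ii) $f$ is lsc and twice continuously differentiable on an open set $\mathcal O\supset{\rm cl}({\rm dom}\,g)$; (iii) $\inf_{x\in\mathbb X}F(x)>-\infty$. The set of stationary points is $S^*:=\{x\in\mathbb X: 0\in\nabla f(x)+\partial g(x)\}$. ${\rm lip}\nabla f(x)$ is the Lipschitz modulus of $\nabla f$ at $x$, i.e. $\limsup_{u,v\to x,\,u\ne v}\|\nabla f(u)-\nabla f(v)\|/\|u-v\|$. **The VMiPG method.** Parameters: $\underline\mu>0$, $\beta\in(0,1)$, $\sigma\in(0,\frac12\min\{1,\underline\mu\})$, a bounded sequence $\{\varepsilon_k\}\subset(0,\infty)$, and $x^0\in{\rm dom}\,g$. It is assumed that there is $\overline k\in\mathbb N$ with $\varepsilon_k\in(0,\underline\mu/10]$ for all $k\ge\overline k$. For $k=0,1,2,\dots$: 1. Select a self-adjoint linear operator $\mathcal G_k:\mathbb X\to\mathbb X$ with $\mathcal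 G_k\succeq\underline\mu\mathcal I$. Let $\Theta_k(x):=f(x^k)+\langle\nabla f(x^k),x-x^k\rangle+\frac12\langle x-x^k,\mathcal G_k(x-x^k)\rangle+g(x)$ and let $\overline x^k$ be its unique minimizer. Choose $y^k$ with $\Theta_k(y^k)<\Theta_k(x^k)$ and $\Theta_k(y^k)-\Theta_k(\overline x^k)\le\varepsilon_k\|y^k-x^k\|^2$. 2. Put $d^k:=y^k-x^k$ and let $m_k$ be the smallest nonnegative integer $m$ with $F(x^k)-F(x^k+\beta^m d^k)\ge\sigma\beta^m\|d^k\|^2$. 3. Put $\alpha_k:=\beta^{m_k}$ and $x^{k+1}:=y^k$ if $F(y^k)<F(x^k+\alpha_kd^k)$, and $x^{k+1}:=x^k+\alpha_kd^k$ otherwise. **KL functions of exponent $\theta$.** A proper function $h:\mathbb X\to\overline{\mathbb R}$ has the KL property of exponent $\theta\in[0,1)$ at $\overline x\in{\rm dom}\,\partial h$ ($\partial h$ the limiting subdifferential) if there are $\delta>0$, $\varpi\in(0,\infty]$, $c>0$ such that, with $\varphi(s)=cs^{1-\theta}$, $\varphi'(h(x)-h(\overline x))\,{\rm dist}(0,\partial h(x))\ge1$ for all $x\in\mathbb B(\overline x,\delta)$ with $h(\overline x)<h(x)<h(\overline x)+\varpi$. $h$ is a KL function of exponent $\theta$ if it has this property at every point of ${\rm dom}\,\partial h$. *)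

theory Defs
  imports "HOL-Analysis.Analysis"
begin

definition edom :: "('a \<Rightarrow> ereal) \<Rightarrow> 'a set" where
  "edom h = {x. h x < \<infinity>}"

definition proper_fun :: "('a \<Rightarrow> ereal) \<Rightarrow> bool" where
  "proper_fun h \<longleftrightarrow> (\<forall>x. h x \<noteq> - \<infinity>) \<and> edom h \<noteq> {}"

definition lsc :: "('a::topological_space \<Rightarrow> ereal) \<Rightarrow> bool" where
  "lsc h \<longleftrightarrow> (\<forall>x. h x \<le> Liminf (at x) h)"

(* Used only for functions that never take the value -\<infinity>; note 0 * \<infinity> = 0 in ereal. *)
definition econvex :: "('a::real_vector \<Rightarrow> ereal) \<Rightarrow> bool" where
  "econvex h \<longleftrightarrow> (\<forall>x y. \<forall>t\<in>{0..1}.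
     h ((1 - t) *\<^sub>R x + t *\<^sub>R y) \<le> ereal (1 - t) * h x + ereal t * h y)"

(* The gradient of the real-valued part of h; meaningful only at points near which h is
   finite and where it is differentiable. *)
definition egrad :: "('a::euclidean_space \<Rightarrow> ereal) \<Rightarrow> 'a \<Rightarrow> 'a" where
  "egrad h x = (THE D. GDERIV (\<lambda>z. real_of_ereal (h z)) x :> D)"

(* To be used for open S. H x is the Hessian of h at x. *)
definition twice_cont_diff_on :: "('a::euclidean_space \<Rightarrow> ereal) \<Rightarrow> 'a set \<Rightarrow> bool" where
  "twice_cont_diff_on h S \<longleftrightarrow>
     (\<forall>x\<in>S. \<bar>h x\<bar> \<noteq> \<infinity>) \<and>
     (\<forall>x\<in>S. GDERIV (\<lambda>z. real_of_ereal (h z)) x :> egrad h x) \<and>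
     (\<exists>H :: 'a \<Rightarrow> 'a \<Rightarrow>\<^sub>L 'a.
        (\<forall>x\<in>S. (egrad h has_derivative blinfun_apply (H x)) (at x)) \<and> continuous_on S H)"

definition regular_subdiff :: "('a::euclidean_space \<Rightarrow> ereal) \<Rightarrow> 'a \<Rightarrow> 'a set" where
  "regular_subdiff h x = {v. \<bar>h x\<bar> \<noteq> \<infinity> \<and>
     0 \<le> Liminf (at x) (\<lambda>z. (h z - h x - ereal (v \<bullet> (z - x))) / ereal (norm (z - x)))}"

definition limiting_subdiff :: "('a::euclidean_space \<Rightarrow> ereal) \<Rightarrow> 'a \<Rightarrow> 'a set" where
  "limiting_subdiff h x = {v. \<bar>h x\<bar> \<noteq> \<infinity> \<and>
     (\<exists>z w. z \<longlonglongrightarrow> x \<and> (\<lambda>n. h (z n)) \<longlonglongrightarrow> h x \<and>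
            (\<forall>n. w n \<in> regular_subdiff h (z n)) \<and> w \<longlonglongrightarrow> v)}"

definition subdiff_dom :: "('a::euclidean_space \<Rightarrow> ereal) \<Rightarrow> 'a set" where
  "subdiff_dom h = {x. limiting_subdiff h x \<noteq> {}}"

(* The infimum is dist(0, limiting_subdiff h x), with value \<infinity> when the subdifferential
   is empty. *)
definition KL_at :: "('a::euclidean_space \<Rightarrow> ereal) \<Rightarrow> real \<Rightarrow> 'a \<Rightarrow> bool" where
  "KL_at h \<theta> xb \<longleftrightarrow>
     (\<exists>\<delta>>0. \<exists>\<omega>::ereal. \<omega> > 0 \<and> (\<exists>c>0. \<forall>x\<in>cball xb \<delta>. h xb < h x \<and> h x < h xb + \<omega> \<longrightarrow>
        ereal (deriv (\<lambda>s. c * s powr (1 - \<theta>)) (real_of_ereal (h x - h xb)))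
          * (INF v\<in>limiting_subdiff h x. ereal (norm v)) \<ge> 1))"

definition KL_function :: "('a::euclidean_space \<Rightarrow> ereal) \<Rightarrow> real \<Rightarrow> bool" where
  "KL_function h \<theta> \<longleftrightarrow> proper_fun h \<and> 0 \<le> \<theta> \<and> \<theta> < 1 \<and> (\<forall>xb\<in>subdiff_dom h. KL_at h \<theta> xb)"

definition composite :: "('a \<Rightarrow> ereal) \<Rightarrow> ('a \<Rightarrow> ereal) \<Rightarrow> 'a \<Rightarrow> ereal" where
  "composite f g x = f x + g x"

definition stationary_points ::
  "('a::euclidean_space \<Rightarrow> ereal) \<Rightarrow> ('a \<Rightarrow> ereal) \<Rightarrow> 'a set" where
  "stationary_points f g = {x. 0 \<in> (\<lambda>v. egrad f x + v) ` limiting_subdiff g x}"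

definition lip_modulus :: "('a::real_normed_vector \<Rightarrow> 'b::real_normed_vector) \<Rightarrow> 'a \<Rightarrow> ereal" where
  "lip_modulus T x = Limsup (at (x, x) within {(u, v). u \<noteq> v})
     (\<lambda>(u, v). ereal (norm (T u - T v) / norm (u - v)))"

definition self_adjoint :: "('a::real_inner \<Rightarrow>\<^sub>L 'a) \<Rightarrow> bool" where
  "self_adjoint Q \<longleftrightarrow> (\<forall>u v. Q u \<bullet> v = u \<bullet> Q v)"

definition loewner_ge :: "('a::real_inner \<Rightarrow>\<^sub>L 'a) \<Rightarrow> ('a \<Rightarrow>\<^sub>L 'a) \<Rightarrow> bool" where
  "loewner_ge Q Q' \<longleftrightarrow> self_adjoint (Q - Q') \<and> (\<forall>v. 0 \<le> v \<bullet> (Q - Q') v)"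

definition Theta ::
  "('a::euclidean_space \<Rightarrow> ereal) \<Rightarrow> ('a \<Rightarrow> ereal) \<Rightarrow> ('a \<Rightarrow>\<^sub>L 'a) \<Rightarrow> 'a \<Rightarrow> 'a \<Rightarrow> ereal" where
  "Theta f g Q xk z =
     f xk + ereal (egrad f xk \<bullet> (z - xk) + 1/2 * ((z - xk) \<bullet> Q (z - xk))) + g z"

definition sufficient_decrease ::
  "('a::euclidean_space \<Rightarrow> ereal) \<Rightarrow> real \<Rightarrow> real \<Rightarrow> 'a \<Rightarrow> 'a \<Rightarrow> nat \<Rightarrow> bool" where
  "sufficient_decrease F \<beta> \<sigma> xk d m \<longleftrightarrow>
     F xk - F (xk + \<beta> ^ m *\<^sub>R d) \<ge> ereal (\<sigma> * \<beta> ^ m * (norm d)\<^sup>2)"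

(* One iteration, from xk to xnext. xbar minimizes the subproblem (uniquely, since the subproblem
   is strongly convex); m is the line-search exponent. *)
definition vmipg_step ::
  "('a::euclidean_space \<Rightarrow> ereal) \<Rightarrow> ('a \<Rightarrow> ereal) \<Rightarrow> real \<Rightarrow> real \<Rightarrow> real \<Rightarrow> real \<Rightarrow>
   ('a \<Rightarrow>\<^sub>L 'a) \<Rightarrow> 'a \<Rightarrow> 'a \<Rightarrow> 'a \<Rightarrow> bool" where
  "vmipg_step f g \<mu>l \<beta> \<sigma> \<epsilon>k Q xk yk xnext \<longleftrightarrow>
     self_adjoint Q \<and> loewner_ge Q (\<mu>l *\<^sub>R id_blinfun) \<and>
     Theta f g Q xk yk < Theta f g Q xk xk \<and>
     (\<exists>xbar. is_arg_min (Theta f g Q xk) (\<lambda>_. True) xbar \<and>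
        Theta f g Q xk yk - Theta f g Q xk xbar \<le> ereal (\<epsilon>k * (norm (yk - xk))\<^sup>2)) \<and>
     (\<exists>m. let F = composite f g; d = yk - xk; \<alpha> = \<beta> ^ m in
        sufficient_decrease F \<beta> \<sigma> xk d m \<and>
        (\<forall>j<m. \<not> sufficient_decrease F \<beta> \<sigma> xk d j) \<and>
        xnext = (if F yk < F (xk + \<alpha> *\<^sub>R d) then yk else xk + \<alpha> *\<^sub>R d))"

definition vmipg_sequence ::
  "('a::euclidean_space \<Rightarrow> ereal) \<Rightarrow> ('a \<Rightarrow> ereal) \<Rightarrow> real \<Rightarrow> real \<Rightarrow> real \<Rightarrow> (nat \<Rightarrow> real) \<Rightarrow>
   (nat \<Rightarrow> 'a \<Rightarrow>\<^sub>L 'a) \<Rightarrow> (nat \<Rightarrow> 'a) \<Rightarrow> (nat \<Rightarrow> 'a) \<Rightarrow> bool" where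
  "vmipg_sequence f g \<mu>l \<beta> \<sigma> \<epsilon>s G x y \<longleftrightarrow>
     \<mu>l > 0 \<and> 0 < \<beta> \<and> \<beta> < 1 \<and> 0 < \<sigma> \<and> \<sigma> < 1/2 * min 1 \<mu>l \<and>
     (\<forall>k. 0 < \<epsilon>s k) \<and> bounded (range \<epsilon>s) \<and> (\<exists>kb. \<forall>k\<ge>kb. \<epsilon>s k \<le> \<mu>l / 10) \<and>
     x 0 \<in> edom g \<and>
     (\<forall>k. vmipg_step f g \<mu>l \<beta> \<sigma> (\<epsilon>s k) (G k) (x k) (y k) (x (Suc k)))"

end

theory Submission
  imports Defs
begin

text \<open>
  Let \<open>D k\<close> be the length of the step from \<open>x k\<close> to \<open>y k\<close>, let \<open>xb k\<close> be the exact minimiser of the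
  subproblem at \<open>x k\<close>, and let \<open>r k\<close> be the gap between the objective at \<open>x k\<close> and the limit of its
  decreasing values. Two inequalities between these numbers imply the theorem.

  The first is \<open>a * (D k)\<^sup>2 \<le> r k - r (Suc k)\<close> (\<open>sufficient_descent\<close>). The whole run stays in a
  compact convex set on which the gradient of \<open>f\<close> is Lipschitz, so the line search accepts every
  step size below a fixed threshold, and its step sizes are bounded away from 0.

  The second is the error bound \<open>r (Suc k) powr \<theta> \<le> C * D k\<close>, eventually (\<open>kl_error_bound\<close>). No
  subgradient of the objective is known at the iterates, but the optimality condition of the
  subproblem provides one at \<open>xb k\<close>, and its norm is of order \<open>D k\<close> because the inexactness
  criterion keeps \<open>xb k\<close> within a multiple of \<open>D k\<close> of \<open>x k\<close> (\<open>xb_close\<close>, \<open>w_small\<close>). The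
  Kurdyka-Lojasiewicz inequality at \<open>xb k\<close> turns this into a bound on the gap at \<open>xb k\<close>. The value
  at the next iterate exceeds the value at \<open>xb k\<close> by at most a multiple of \<open>(D k)\<^sup>2\<close>
  (\<open>next_value_le_exact_value\<close>); here it matters that the method moves to \<open>y k\<close> whenever that is
  better than the line-search point. Since \<open>1 / 2 \<le> \<theta>\<close>, this excess does not spoil the bound.

  The rest concerns sequences of real numbers (\<open>kl_descent_rate\<close>). The two inequalities make
  the remaining length of the path of order \<open>r k powr (1 - \<theta>)\<close>, so the iterates converge, and
  eliminating \<open>D\<close> gives a recursion for \<open>r\<close> alone that determines its decay. The limit is
  stationary because the subgradients at \<open>xb k\<close> tend to 0 (\<open>cluster_point\<close>).
\<close>

section \<open>Descent sequences with an error bound\<close>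

text \<open>
  The mean value theorem for the power with exponent \<open>e\<close>, whose derivative is decreasing up to the
  factor \<open>e\<close>. Dividing by \<open>e\<close> lets one inequality serve both the concave desingularising
  powers (\<open>0 < e\<close>) and the convex, decreasing powers (\<open>e < 0\<close>) that measure polynomial decay.
\<close>

lemma powr_tangent_bound:
  fixes s t e :: real
  assumes s: "0 < s" "s \<le> t" and e: "e \<le> 1" "e \<noteq> 0"
  shows "t powr (e - 1) * (t - s) \<le> (t powr e - s powr e) / e"
proof (cases "s = t")
  case False
  with s have "s < t" by simp
  have "\<exists>z. s < z \<and> z < t \<and> t powr e - s powr e = (t - s) * (e * z powr (e - 1))"
    using s by (intro MVT2[OF \<open>s < t\<close>]) (auto intro!: derivative_eq_intros)
  then obtain z where z: "s < z" "z < t" "t powr e - s powr e = (t - s) * (e * z powr (e - 1))"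
    by blast
  have "t powr (e - 1) \<le> z powr (e - 1)"
    using z s e by (intro powr_mono2') auto
  then have "t powr (e - 1) * (t - s) \<le> z powr (e - 1) * (t - s)"
    using s by (intro mult_right_mono) auto
  also have "\<dots> = (t powr e - s powr e) / e"
    using z e by simp
  finally show ?thesis .
qed simp

lemma geometric_decay_of_recursion:
  fixes r :: "nat \<Rightarrow> real"
  assumes M: "0 < M" and rec: "\<And>k. k \<ge> N \<Longrightarrow> r (Suc k) \<le> M * (r k - r (Suc k))"
  shows "k \<ge> N \<Longrightarrow> r k \<le> r N / (M / (1 + M)) ^ N * (M / (1 + M)) ^ k"
proof (induction k rule: dec_induct)
  case base
  show ?case using M by simp
next
  case (step k)
  have "r (Suc k) * (1 + M) \<le> M * r k"
    using rec[OF step(1)] by (simp add: algebra_simps)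
  then have "r (Suc k) \<le> M / (1 + M) * r k"
    using M by (simp add: field_simps)
  also have "\<dots> \<le> M / (1 + M) * (r N / (M / (1 + M)) ^ N * (M / (1 + M)) ^ k)"
    using step.IH M by (intro mult_left_mono) auto
  finally show ?case by (simp add: mult_ac)
qed

text \<open>
  The reciprocal power \<open>u k = r k powr (1 - p)\<close> grows at least linearly. If a step shrinks \<open>r\<close> by
  at most a factor 2, the recursion, which bounds the decrease from below by a power of the
  later value, is as good as one with the earlier value, and the tangent bound gives a
  fixed increment of \<open>u\<close>. If \<open>r\<close> more than halves, \<open>u\<close> is multiplied by \<open>2 powr (p - 1) > 1\<close>, which
  adds at least a fixed multiple of its initial value.
\<close>

lemma polynomial_decay_of_recursion:
  fixes r :: "nat \<Rightarrow> real"
  assumes pos: "\<And>k. 0 < r k" and M: "0 < M" and p: "1 < p"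
    and rec: "\<And>k. k \<ge> N \<Longrightarrow> r (Suc k) powr p \<le> M * (r k - r (Suc k))"
  obtains m where "0 < m" "\<And>k. k > N \<Longrightarrow> r k \<le> (m * real (k - N)) powr (- 1 / (p - 1))"
proof -
  define u where "u k = r k powr (1 - p)" for k
  define m where "m = min ((p - 1) * 2 powr - p / M) ((2 powr (p - 1) - 1) * u N)"
  have u_pos: "0 < u k" for k
    using pos[of k] by (simp add: u_def)
  have "1 < 2 powr (p - 1)"
    using p powr_less_mono[of 0 "p - 1" "2::real"] by simp
  then have m_pos: "0 < m"
    using M p u_pos by (simp add: m_def)
  have dec: "r (Suc k) \<le> r k" if "k \<ge> N" for k
  proof -
    have "0 \<le> M * (r k - r (Suc k))"
      using order_trans[OF powr_ge_zero rec[OF that]] .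
    then show ?thesis using M by (simp add: zero_le_mult_iff)
  qed
  have u_grows: "u k + m \<le> u (Suc k)" if k: "k \<ge> N" and ukN: "u N \<le> u k" for k
  proof (cases "r k \<le> 2 * r (Suc k)")
    case True
    have "(r k / 2) powr p \<le> r (Suc k) powr p"
      using True pos p by (intro powr_mono2) (auto simp: less_imp_le)
    also have "\<dots> \<le> M * (r k - r (Suc k))"
      by (rule rec[OF k])
    finally have a: "(r k / 2) powr p / M \<le> r k - r (Suc k)"
      using M by (simp add: field_simps)
    have "2 powr - p / M = r k powr - p * ((r k / 2) powr p / M)"
      using pos[of k] by (simp add: powr_divide powr_minus field_simps)
    also have "\<dots> \<le> r k powr - p * (r k - r (Suc k))"
      using a by (intro mult_left_mono) auto
    also have "\<dots> \<le> (u k - u (Suc k)) / (1 - p)"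
      using powr_tangent_bound[of "r (Suc k)" "r k" "1 - p"] pos dec[OF k] p
      by (simp add: u_def)
    finally have "(p - 1) * (2 powr - p / M) \<le> (p - 1) * ((u k - u (Suc k)) / (1 - p))"
      using p by (intro mult_left_mono) auto
    also have "\<dots> = u (Suc k) - u k"
      using p by (simp add: field_simps)
    finally show ?thesis by (simp add: m_def)
  next
    case False
    have "2 powr (p - 1) * u k = (r k / 2) powr (1 - p)"
      using pos[of k] by (simp add: u_def powr_divide powr_diff field_simps)
    also have "\<dots> \<le> u (Suc k)"
      unfolding u_def using False pos p by (intro powr_mono2') auto
    finally have "2 powr (p - 1) * u k \<le> u (Suc k)" .
    moreover have "(2 powr (p - 1) - 1) * u N \<le> (2 powr (p - 1) - 1) * u k"
      using ukN \<open>1 < 2 powr (p - 1)\<close> by (intro mult_left_mono) auto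
    moreover have "m \<le> (2 powr (p - 1) - 1) * u N"
      by (simp add: m_def)
    ultimately show ?thesis by (simp add: algebra_simps)
  qed
  have u_lower: "u N + m * real (k - N) \<le> u k" if "k \<ge> N" for k
    using that
  proof (induction k rule: dec_induct)
    case base
    show ?case by simp
  next
    case (step k)
    have "0 \<le> m * real (k - N)" using m_pos by simp
    with step.IH have "u N \<le> u k" by linarith
    from u_grows[OF step(1) this] step show ?case
      by (simp add: Suc_diff_le algebra_simps)
  qed
  show ?thesis
  proof
    fix k assume k: "k > N"
    have "r k = u k powr (- 1 / (p - 1))"
    proof -
      have "(1 - p) * (- 1 / (p - 1)) = 1" using p by (simp add: field_simps)
      then show ?thesis using pos[of k] by (simp only: u_def powr_powr) simp
    qed
    also have "\<dots> \<le> (m * real (k - N)) powr (- 1 / (p - 1))"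
      using u_lower[of k] u_pos[of N] k m_pos p by (intro powr_mono2') auto
    finally show "r k \<le> (m * real (k - N)) powr (- 1 / (p - 1))" .
  qed (fact m_pos)
qed

text \<open>
  Multiplying the descent inequality by the slope of the concave function \<open>s powr (1 - \<theta>)\<close> and
  using the error bound of the previous step gives
  \<open>(D (Suc k))\<^sup>2 \<le> D k * (B * (\<phi> (Suc k) - \<phi> (Suc (Suc k))))\<close>. By the arithmetic-geometric mean
  inequality half of \<open>D k\<close> and a telescoping term dominate \<open>D (Suc k)\<close>, so the tail sums of \<open>D\<close>
  are controlled by the first term and \<open>\<phi>\<close>. The first term is of order \<open>sqrt (r k)\<close>, which for
  \<open>1 / 2 \<le> \<theta>\<close> is of order \<open>r k powr (1 - \<theta>)\<close> as well.
\<close>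

lemma kl_descent_finite_length:
  fixes r D :: "nat \<Rightarrow> real"
  assumes \<theta>: "1 / 2 \<le> \<theta>" "\<theta> < 1" and a: "0 < a" and C: "0 < C"
    and D: "\<And>k. 0 < D k" and r: "\<And>k. 0 < r k"
    and descent: "\<And>k. a * (D k)\<^sup>2 \<le> r k - r (Suc k)"
    and kl: "\<And>k. k \<ge> N \<Longrightarrow> r (Suc k) powr \<theta> \<le> C * D k"
  obtains E where "0 < E" "\<And>k n. N \<le> k \<Longrightarrow> k \<le> n \<Longrightarrow> (\<Sum>j=k..<n. D j) \<le> E * r k powr (1 - \<theta>)"
proof -
  define B where "B = C / ((1 - \<theta>) * a)"
  define \<phi> where "\<phi> k = r k powr (1 - \<theta>)" for k
  have B: "0 < B" using \<theta> a C by (simp add: B_def)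
  have \<phi>: "0 < \<phi> k" for k using r[of k] by (simp add: \<phi>_def)
  have dec: "r (Suc k) \<le> r k" for k
    using descent[of k] a zero_le_power2[of "D k"] by (smt (verit) mult_nonneg_nonneg)
  have half: "2 * D (Suc k) \<le> D k + B * (\<phi> (Suc k) - \<phi> (Suc (Suc k)))" if k: "k \<ge> N" for k
  proof -
    define \<Delta> where "\<Delta> = \<phi> (Suc k) - \<phi> (Suc (Suc k))"
    have "a * (D (Suc k))\<^sup>2 / (C * D k) \<le> (r (Suc k) - r (Suc (Suc k))) / r (Suc k) powr \<theta>"
      using descent[of "Suc k"] kl[OF k] r[of "Suc k"] a dec[of "Suc k"] by (intro frac_le) auto
    also have "\<dots> = r (Suc k) powr (1 - \<theta> - 1) * (r (Suc k) - r (Suc (Suc k)))"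
      by (simp add: powr_minus field_simps)
    also have "\<dots> \<le> \<Delta> / (1 - \<theta>)"
      unfolding \<Delta>_def \<phi>_def using \<theta> r dec by (intro powr_tangent_bound) auto
    finally have "(D (Suc k))\<^sup>2 \<le> D k * (B * \<Delta>)"
      using \<theta> a C D[of k] by (simp add: B_def field_simps)
    also have "\<dots> \<le> ((D k + B * \<Delta>) / 2)\<^sup>2"
      using zero_le_power2[of "D k - B * \<Delta>"] by (simp add: power2_eq_square field_simps)
    finally have sq: "(D (Suc k))\<^sup>2 \<le> ((D k + B * \<Delta>) / 2)\<^sup>2" .
    have "\<phi> (Suc (Suc k)) \<le> \<phi> (Suc k)"
      unfolding \<phi>_def using \<theta> r dec by (intro powr_mono2) (auto simp: less_imp_le)
    then have "0 \<le> (D k + B * \<Delta>) / 2"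
      using D[of k] B by (simp add: \<Delta>_def)
    with sq have "D (Suc k) \<le> (D k + B * \<Delta>) / 2"
      by (rule power2_le_imp_le)
    then show ?thesis by (simp add: \<Delta>_def)
  qed
  have sums: "(\<Sum>j=Suc k..n. D j) \<le> D k - D n + B * (\<phi> (Suc k) - \<phi> (Suc n))"
    if "N \<le> k" "k \<le> n" for k n
    using that(2)
  proof (induction n rule: dec_induct)
    case base
    show ?case by simp
  next
    case (step n)
    show ?case using step half[of n] that(1) by (simp add: algebra_simps)
  qed
  define E where "E = 2 * (r N powr (\<theta> - 1 / 2) / sqrt a) + B"
  have E: "0 < E"
    using B a r[of N] by (simp add: E_def add_nonneg_pos)
  show ?thesis
  proof
    show "0 < E" by (fact E)
    fix k n assume kn: "N \<le> k" "k \<le> n"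
    have "a * (D k)\<^sup>2 \<le> r k"
      using descent[of k] r[of "Suc k"] by linarith
    then have "D k \<le> sqrt (r k / a)"
      using a by (intro real_le_rsqrt) (simp add: field_simps)
    also have "\<dots> = r k powr (1 - \<theta>) * r k powr (\<theta> - 1 / 2) / sqrt a"
      using r[of k] by (simp add: real_sqrt_divide powr_add [symmetric] powr_half_sqrt)
    also have "\<dots> \<le> r k powr (1 - \<theta>) * r N powr (\<theta> - 1 / 2) / sqrt a"
      using lift_Suc_antimono_le[of r, OF dec kn(1)] r[of k] \<theta> a
      by (intro divide_right_mono mult_left_mono powr_mono2) auto
    finally have Dk: "D k \<le> r N powr (\<theta> - 1 / 2) / sqrt a * \<phi> k"
      by (simp add: \<phi>_def mult_ac)
    have \<phi>dec: "\<phi> (Suc k) \<le> \<phi> k"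
      unfolding \<phi>_def using \<theta> r dec by (intro powr_mono2) (auto simp: less_imp_le)
    have "(\<Sum>j=k..<n. D j) \<le> (\<Sum>j=k..n. D j)"
      using D by (intro sum_mono2) (auto simp: less_imp_le)
    also have "\<dots> = D k + (\<Sum>j=Suc k..n. D j)"
      using kn by (simp add: sum.atLeast_Suc_atMost)
    also have "\<dots> \<le> 2 * D k + B * \<phi> k"
    proof -
      have "B * (\<phi> (Suc k) - \<phi> (Suc n)) \<le> B * \<phi> k"
        using B \<phi>dec \<phi>[of "Suc n"] by (intro mult_left_mono) auto
      then show ?thesis using sums[OF kn] D[of n] by linarith
    qed
    also have "\<dots> \<le> 2 * (r N powr (\<theta> - 1 / 2) / sqrt a * \<phi> k) + B * \<phi> k"
      using Dk by linarith
    also have "\<dots> = E * \<phi> k"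
      by (simp only: E_def distrib_right mult.assoc)
    finally show "(\<Sum>j=k..<n. D j) \<le> E * r k powr (1 - \<theta>)"
      by (simp add: \<phi>_def)
  qed
qed

text \<open>
  The distance to the limit is at most the remaining length, hence of order
  \<open>r k powr (1 - \<theta>)\<close>. Squaring the error bound and inserting it into the descent inequality
  gives the recursion \<open>r (Suc k) powr (2 * \<theta>) \<le> M * (r k - r (Suc k))\<close>, whose solutions decay
  geometrically for \<open>\<theta> = 1 / 2\<close> and like \<open>k powr (- 1 / (2 * \<theta> - 1))\<close> for larger \<open>\<theta>\<close>.
\<close>

lemma kl_descent_rate:
  fixes x :: "nat \<Rightarrow> 'a::banach" and r D :: "nat \<Rightarrow> real"
  assumes \<theta>: "1 / 2 \<le> \<theta>" "\<theta> < 1" and a: "0 < a"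
    and D: "\<And>k. 0 < D k" and r: "\<And>k. 0 < r k"
    and descent: "\<And>k. a * (D k)\<^sup>2 \<le> r k - r (Suc k)"
    and kl: "\<forall>\<^sub>F k in sequentially. r (Suc k) powr \<theta> \<le> C * D k"
    and step: "\<And>k. norm (x (Suc k) - x k) \<le> D k"
  obtains xbar \<rho> c where "x \<longlonglongrightarrow> xbar" "0 < \<rho>" "\<rho> < 1" "0 < c"
    "\<forall>\<^sub>F k in sequentially. norm (x k - xbar) \<le>
       (if \<theta> = 1 / 2 then c * \<rho> ^ k else c * real k powr ((1 - \<theta>) / (1 - 2 * \<theta>)))"
proof -
  from kl obtain N where N: "\<And>k. k \<ge> N \<Longrightarrow> r (Suc k) powr \<theta> \<le> C * D k"
    by (auto simp: eventually_sequentially)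
  have C: "0 < C"
  proof -
    have "0 < r (Suc N) powr \<theta>" using r[of "Suc N"] by simp
    also have "\<dots> \<le> C * D N" by (rule N) simp
    finally show ?thesis using D[of N] by (simp add: zero_less_mult_iff)
  qed
  obtain E where E: "0 < E"
    and len: "\<And>k n. N \<le> k \<Longrightarrow> k \<le> n \<Longrightarrow> (\<Sum>j=k..<n. D j) \<le> E * r k powr (1 - \<theta>)"
    using kl_descent_finite_length[of \<theta> a C D r N] \<theta> a C D r descent N by blast
  have dist_le: "norm (x n - x k) \<le> (\<Sum>j=k..<n. D j)" if "k \<le> n" for k n
  proof -
    have "x n - x k = (\<Sum>j=k..<n. x (Suc j) - x j)"
      using that by (simp add: sum_Suc_diff')
    also have "norm \<dots> \<le> (\<Sum>j=k..<n. D j)"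
      by (intro sum_norm_le step)
    finally show ?thesis .
  qed
  have "summable D"
  proof (rule summableI_nonneg_bounded)
    show "0 \<le> D n" for n using D[of n] by simp
    show "(\<Sum>j<n. D j) \<le> (\<Sum>j<N. D j) + E * r N powr (1 - \<theta>)" for n
    proof -
      have "(\<Sum>j<n. D j) \<le> (\<Sum>j<max n N. D j)"
        using D by (intro sum_mono2) (auto simp: less_imp_le)
      also have "\<dots> = (\<Sum>j<N. D j) + (\<Sum>j=N..<max n N. D j)"
        by (simp add: lessThan_atLeast0 sum.atLeastLessThan_concat)
      finally show ?thesis using len[of N "max n N"] by simp
    qed
  qed
  then have "summable (\<lambda>k. x (Suc k) - x k)"
    by (rule summable_comparison_test') (rule step)
  then have "convergent (\<lambda>n. \<Sum>k<n. x (Suc k) - x k)"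
    by (simp add: summable_iff_convergent)
  then obtain s where "(\<lambda>n. x n - x 0) \<longlonglongrightarrow> s"
    by (auto simp: sum_lessThan_telescope convergent_def)
  then have "(\<lambda>n. (x n - x 0) + x 0) \<longlonglongrightarrow> s + x 0"
    by (intro tendsto_add tendsto_const)
  then obtain xbar where lim: "x \<longlonglongrightarrow> xbar"
    by auto
  have tail: "norm (x k - xbar) \<le> E * r k powr (1 - \<theta>)" if k: "k \<ge> N" for k
  proof (rule tendsto_upperbound)
    show "(\<lambda>n. norm (x k - x n)) \<longlonglongrightarrow> norm (x k - xbar)"
      by (intro tendsto_intros lim)
    show "\<forall>\<^sub>F n in sequentially. norm (x k - x n) \<le> E * r k powr (1 - \<theta>)"
      using eventually_ge_at_top[of k]
    proof eventually_elim
      case (elim n)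
      then show ?case using dist_le[of k n] len[OF k elim] by (simp add: norm_minus_commute)
    qed
  qed simp
  have rec: "r (Suc k) powr (2 * \<theta>) \<le> C\<^sup>2 / a * (r k - r (Suc k))" if k: "k \<ge> N" for k
  proof -
    have "r (Suc k) powr (2 * \<theta>) = (r (Suc k) powr \<theta>)\<^sup>2"
      using r[of "Suc k"] by (simp add: power2_eq_square powr_add [symmetric])
    also have "\<dots> \<le> (C * D k)\<^sup>2"
      using N[OF k] by (intro power_mono) auto
    also have "\<dots> = C\<^sup>2 / a * (a * (D k)\<^sup>2)"
      using a by (simp add: power_mult_distrib)
    also have "\<dots> \<le> C\<^sup>2 / a * (r k - r (Suc k))"
      using descent[of k] a by (intro mult_left_mono) auto
    finally show ?thesis .
  qed
  have M: "0 < C\<^sup>2 / a" using C a by simp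
  show ?thesis
  proof (cases "\<theta> = 1 / 2")
    case True
    define q where "q = C\<^sup>2 / a / (1 + C\<^sup>2 / a)"
    have "0 < M / (1 + M) \<and> M / (1 + M) < 1" if "0 < M" for M :: real
      using that by (simp add: field_simps)
    then have q: "0 < q" "q < 1"
      using M unfolding q_def by blast+
    define K where "K = r N / q ^ N"
    have K: "0 < K" using q r[of N] by (simp add: K_def)
    have rk: "r k \<le> K * q ^ k" if "k \<ge> N" for k
      unfolding K_def q_def
    proof (rule geometric_decay_of_recursion[OF M _ that])
      show "r (Suc j) \<le> C\<^sup>2 / a * (r j - r (Suc j))" if "N \<le> j" for j
        using rec[OF that] True r[of "Suc j"] by simp
    qed
    show ?thesis
    proof (rule that[OF lim, of "sqrt q" "E * sqrt K"])
      show "\<forall>\<^sub>F k in sequentially. norm (x k - xbar) \<le> (if \<theta> = 1 / 2 then E * sqrt K * sqrt q ^ k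
          else E * sqrt K * real k powr ((1 - \<theta>) / (1 - 2 * \<theta>)))"
        using eventually_ge_at_top[of N]
      proof eventually_elim
        case (elim k)
        have "norm (x k - xbar) \<le> E * sqrt (r k)"
          using tail[OF elim] True r[of k] by (simp add: powr_half_sqrt)
        also have "\<dots> \<le> E * sqrt (K * q ^ k)"
          using rk[OF elim] E by simp
        finally show ?case
          using True by (simp add: real_sqrt_mult real_sqrt_power)
      qed
    qed (use q E K in auto)
  next
    case False
    define e where "e = (1 - \<theta>) / (1 - 2 * \<theta>)"
    have e: "e \<le> 0" using \<theta> by (simp add: e_def divide_nonneg_nonpos)
    have e_eq: "- 1 / (2 * \<theta> - 1) * (1 - \<theta>) = e"
      using \<theta> False by (simp add: e_def field_simps)
    obtain m where m: "0 < m"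
      and rk: "\<And>k. k > N \<Longrightarrow> r k \<le> (m * real (k - N)) powr (- 1 / (2 * \<theta> - 1))"
      using polynomial_decay_of_recursion[of r "C\<^sup>2 / a" "2 * \<theta>" N] r M \<theta> False rec
      by (metis less_eq_real_def mult_2 field_sum_of_halves add_strict_mono)
    \<comment> \<open>The value \<open>1 / 2\<close> for \<open>\<rho>\<close> is arbitrary, and \<open>k > 2 * N\<close> allows replacing \<open>k - N\<close> by \<open>k / 2\<close>.\<close>
    show ?thesis
    proof (rule that[OF lim, of "1 / 2" "E * (m / 2) powr e"])
      show "\<forall>\<^sub>F k in sequentially. norm (x k - xbar) \<le>
          (if \<theta> = 1 / 2 then E * (m / 2) powr e * (1 / 2) ^ k
           else E * (m / 2) powr e * real k powr ((1 - \<theta>) / (1 - 2 * \<theta>)))"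
        using eventually_gt_at_top[of "2 * N"]
      proof eventually_elim
        case (elim k)
        have "r k powr (1 - \<theta>) \<le> ((m * real (k - N)) powr (- 1 / (2 * \<theta> - 1))) powr (1 - \<theta>)"
          using rk[of k] elim r[of k] \<theta> by (intro powr_mono2) auto
        also have "\<dots> = (m * real (k - N)) powr e"
          by (simp only: powr_powr e_eq)
        also have "\<dots> \<le> (m * (real k / 2)) powr e"
          using elim m e by (intro powr_mono2' mult_left_mono) auto
        also have "\<dots> = (m / 2) powr e * real k powr e"
          using m by (simp add: powr_mult [symmetric])
        finally have "E * r k powr (1 - \<theta>) \<le> E * ((m / 2) powr e * real k powr e)"
          using E by (intro mult_left_mono) auto
        then show ?case
          using tail[of k] elim False by (simp add: e_def mult_ac)
      qed
    qed (use E m in auto)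
  qed
qed

lemma powr_sum_le:
  fixes a b \<theta> :: real
  assumes "0 \<le> a" "0 \<le> b" "0 \<le> \<theta>" "\<theta> \<le> 1"
  shows "(a + b) powr \<theta> \<le> 2 * (a powr \<theta> + b powr \<theta>)"
proof -
  have "(a + b) powr \<theta> \<le> (2 * max a b) powr \<theta>"
    using assms by (intro powr_mono2) auto
  also have "\<dots> = 2 powr \<theta> * max a b powr \<theta>"
    using assms by (simp add: powr_mult)
  also have "\<dots> \<le> 2 * (a powr \<theta> + b powr \<theta>)"
    using assms powr_mono[of \<theta> 1 "2::real"] by (intro mult_mono) (auto simp: max_def)
  finally show ?thesis .
qed

section \<open>Subgradients and the Kurdyka-Lojasiewicz inequality\<close>

text \<open>
  The defining lower limit skips the point \<open>x\<close> itself, but a value \<open>h x\<close> above \<open>B\<close> extends the bound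
  from the punctured to the full neighbourhood, so the sequence may hit its limit.
\<close>

lemma lsc_bounded_at_limit:
  fixes h :: "'a::metric_space \<Rightarrow> ereal"
  assumes "lsc h" and X: "X \<longlonglongrightarrow> x" and B: "\<And>n. h (X n) \<le> B"
  shows "h x \<le> B"
proof (rule ccontr)
  assume "\<not> h x \<le> B"
  then have "B < h x" by simp
  also have "h x \<le> Liminf (at x) h" using assms(1) by (simp add: lsc_def)
  finally have "\<forall>\<^sub>F z in at x. B < h z" by (rule less_LiminfD)
  with \<open>B < h x\<close> have "\<forall>\<^sub>F z in nhds x. B < h z"
    by (auto simp: eventually_at_filter elim!: eventually_mono)
  then have "\<forall>\<^sub>F n in sequentially. B < h (X n)"
    using X by (auto simp: filterlim_iff)
  then show False
    using B by (auto simp: eventually_sequentially not_less [symmetric])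
qed

lemma convex_edom: "econvex h \<Longrightarrow> convex (edom h)"
  unfolding convex_alt
proof safe
  fix x y and t :: real
  assume h: "econvex h" "x \<in> edom h" "y \<in> edom h" and t: "0 \<le> t" "t \<le> 1"
  have "h ((1 - t) *\<^sub>R x + t *\<^sub>R y) \<le> ereal (1 - t) * h x + ereal t * h y"
    using h t by (auto simp: econvex_def)
  also have "\<dots> < \<infinity>"
    using h t by (cases "h x"; cases "h y") (auto simp: edom_def)
  finally show "(1 - t) *\<^sub>R x + t *\<^sub>R y \<in> edom h"
    by (simp add: edom_def)
qed

definition convex_subgradient :: "('a::real_inner \<Rightarrow> ereal) \<Rightarrow> 'a \<Rightarrow> 'a \<Rightarrow> bool" where
  "convex_subgradient h x v \<longleftrightarrow> (\<forall>z. h x + ereal (v \<bullet> (z - x)) \<le> h z)"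

text \<open>
  A sum rule in its easy direction: the subgradient inequality of \<open>g\<close> is global, so the
  difference quotient of \<open>f + g\<close> is bounded below by the Taylor remainder quotient of \<open>f\<close>,
  which vanishes.
\<close>

lemma regular_subdiff_composite:
  fixes f g :: "'a::euclidean_space \<Rightarrow> ereal"
  assumes g: "\<And>z. g z \<noteq> - \<infinity>" "\<bar>g x\<bar> \<noteq> \<infinity>" "convex_subgradient g x v"
    and S: "open S" "x \<in> S" "\<And>z. z \<in> S \<Longrightarrow> \<bar>f z\<bar> \<noteq> \<infinity>"
    and f: "GDERIV (\<lambda>z. real_of_ereal (f z)) x :> D"
  shows "D + v \<in> regular_subdiff (composite f g) x"
proof -
  define F where "F = composite f g"
  have Fx: "\<bar>F x\<bar> \<noteq> \<infinity>"
    using g(2) S(3)[OF S(2)] by (auto simp: F_def composite_def)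
  have "0 \<le> Liminf (at x) (\<lambda>z. (F z - F x - ereal ((D + v) \<bullet> (z - x))) / ereal (norm (z - x)))"
    unfolding le_Liminf_iff
  proof (intro allI impI)
    fix l :: ereal assume "l < 0"
    then obtain m where m: "l < ereal m" "m < 0"
      using ereal_dense2[of l 0] by (auto simp: zero_ereal_def)
    have "((\<lambda>z. norm (real_of_ereal (f z) - real_of_ereal (f x) - (z - x) \<bullet> D) / norm (z - x))
        \<longlongrightarrow> 0) (at x)"
      using f by (simp add: gderiv_def has_derivative_iff_norm)
    then have "\<forall>\<^sub>F z in at x.
        norm (real_of_ereal (f z) - real_of_ereal (f x) - (z - x) \<bullet> D) / norm (z - x) < - m"
      using m by (intro order_tendstoD) auto
    moreover have "\<forall>\<^sub>F z in at x. z \<in> S" "\<forall>\<^sub>F z in at x. z \<noteq> x"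
      using S by (auto simp: eventually_at_filter eventually_nhds)
    ultimately show "\<forall>\<^sub>F z in at x.
        l < (F z - F x - ereal ((D + v) \<bullet> (z - x))) / ereal (norm (z - x))"
    proof eventually_elim
      case (elim z)
      have n: "0 < norm (z - x)" using elim by simp
      obtain p where p: "f x = ereal p" using S(3)[OF S(2)] by auto
      obtain p' where p': "f z = ereal p'" using S(3)[OF elim(2)] by auto
      obtain q where q: "g x = ereal q" using g(2) by auto
      show ?case
      proof (cases "g z")
        case (real q')
        have "q + v \<bullet> (z - x) \<le> q'"
          using g(3) q real unfolding convex_subgradient_def
          by (metis ereal_less_eq(3) plus_ereal.simps(1))
        moreover have "\<bar>p' - p - (z - x) \<bullet> D\<bar> < - m * norm (z - x)"
          using elim(1) n by (simp add: p p' pos_divide_less_eq)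
        ultimately have "m * norm (z - x) < p' + q' - (p + q) - (D + v) \<bullet> (z - x)"
          by (simp add: inner_add_left inner_commute[of "z - x" D])
        then have "m < (p' + q' - (p + q) - (D + v) \<bullet> (z - x)) / norm (z - x)"
          using n by (simp add: pos_less_divide_eq)
        then have "ereal m < (F z - F x - ereal ((D + v) \<bullet> (z - x))) / ereal (norm (z - x))"
          using n elim(3) by (simp add: F_def composite_def p p' q real)
        with m show ?thesis by simp
      next
        case PInf
        then show ?thesis
          using n elim(3) \<open>l < 0\<close> by (auto simp: F_def composite_def p p' q)
      next
        case MInf
        then show ?thesis using g(1) by simp
      qed
    qed
  qed
  with Fx show ?thesis by (simp add: regular_subdiff_def F_def)
qed

lemma convex_subgradient_regular:
  fixes g :: "'a::euclidean_space \<Rightarrow> ereal"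
  assumes "\<And>z. g z \<noteq> - \<infinity>" "\<bar>g x\<bar> \<noteq> \<infinity>" "convex_subgradient g x v"
  shows "v \<in> regular_subdiff g x"
  using regular_subdiff_composite[of g x v UNIV "\<lambda>_. 0" 0] assms GDERIV_const[of 0 x]
  by (simp add: composite_def[abs_def])

lemma limiting_subdiffI:
  assumes "\<bar>h x\<bar> \<noteq> \<infinity>" "z \<longlonglongrightarrow> x" "(\<lambda>n. h (z n)) \<longlonglongrightarrow> h x"
    "\<And>n. w n \<in> regular_subdiff h (z n)" "w \<longlonglongrightarrow> v"
  shows "v \<in> limiting_subdiff h x"
  using assms unfolding limiting_subdiff_def by blast

lemma KL_at_real:
  fixes h :: "'a::euclidean_space \<Rightarrow> ereal"
  assumes "KL_at h \<theta> z" and \<theta>: "\<theta> < 1"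
  obtains \<delta> \<omega> c where "0 < \<delta>" "0 < (\<omega>::ereal)" "0 < c"
    "\<And>u v s. u \<in> cball z \<delta> \<Longrightarrow> h u - h z = ereal s \<Longrightarrow> h z < h u \<Longrightarrow> h u < h z + \<omega> \<Longrightarrow> 0 < s \<Longrightarrow>
       v \<in> limiting_subdiff h u \<Longrightarrow> s powr \<theta> \<le> c * norm v"
proof -
  from assms obtain \<delta> \<omega> c where pos: "0 < \<delta>" "0 < (\<omega>::ereal)" "0 < c"
    and KL: "\<And>u. u \<in> cball z \<delta> \<Longrightarrow> h z < h u \<Longrightarrow> h u < h z + \<omega> \<Longrightarrow>
       1 \<le> ereal (deriv (\<lambda>s. c * s powr (1 - \<theta>)) (real_of_ereal (h u - h z)))
          * (INF v\<in>limiting_subdiff h u. ereal (norm v))"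
    unfolding KL_at_def by blast
  show ?thesis
  proof (rule that[OF pos(1,2), of "c * (1 - \<theta>)"])
    show "0 < c * (1 - \<theta>)" using pos \<theta> by simp
    fix u v s
    assume u: "u \<in> cball z \<delta>" "h z < h u" "h u < h z + \<omega>" and s: "h u - h z = ereal s" "0 < s"
      and v: "v \<in> limiting_subdiff h u"
    have "((\<lambda>s. c * s powr (1 - \<theta>)) has_real_derivative c * ((1 - \<theta>) * s powr - \<theta>)) (at s)"
      using s by (auto intro!: derivative_eq_intros)
    then have "deriv (\<lambda>s. c * s powr (1 - \<theta>)) (real_of_ereal (h u - h z)) = c * ((1 - \<theta>) * s powr - \<theta>)"
      using s by (simp add: DERIV_imp_deriv)
    then have "1 \<le> ereal (c * ((1 - \<theta>) * s powr - \<theta>)) * (INF v\<in>limiting_subdiff h u. ereal (norm v))"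
      using KL[OF u] by simp
    also have "\<dots> \<le> ereal (c * ((1 - \<theta>) * s powr - \<theta>)) * ereal (norm v)"
      using pos \<theta> v by (intro ereal_mult_left_mono INF_lower) auto
    finally have "1 \<le> c * ((1 - \<theta>) * s powr - \<theta>) * norm v"
      by simp
    then show "s powr \<theta> \<le> c * (1 - \<theta>) * norm v"
      using s by (simp add: powr_minus field_simps)
  qed
qed

section \<open>Smoothness on compact convex sets\<close>

text \<open>
  The Hessian is bounded on \<open>K\<close>. The constant in the second estimate is twice the optimal one,
  which spares integrating along the segment: one application of the mean value theorem
  and the Lipschitz bound for the gradient suffice.
\<close>

lemma C1_bounds_on_compact_convex:
  fixes f :: "'a::euclidean_space \<Rightarrow> ereal"
  assumes f: "twice_cont_diff_on f S" and K: "compact K" "convex K" "K \<subseteq> S"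
  obtains L where "0 < L"
    "\<And>a b. a \<in> K \<Longrightarrow> b \<in> K \<Longrightarrow> norm (egrad f b - egrad f a) \<le> L * norm (b - a)"
    "\<And>a b. a \<in> K \<Longrightarrow> b \<in> K \<Longrightarrow>
       \<bar>real_of_ereal (f b) - real_of_ereal (f a) - egrad f a \<bullet> (b - a)\<bar> \<le> L * (norm (b - a))\<^sup>2"
proof -
  obtain H :: "'a \<Rightarrow> 'a \<Rightarrow>\<^sub>L 'a"
    where H: "\<And>z. z \<in> S \<Longrightarrow> (egrad f has_derivative blinfun_apply (H z)) (at z)"
      and H_cont: "continuous_on S H"
    using f by (auto simp: twice_cont_diff_on_def)
  have "bounded (H ` K)"
    using K H_cont by (intro compact_imp_bounded compact_continuous_image)
      (auto intro: continuous_on_subset)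
  then obtain L where L: "0 < L" "\<And>z. z \<in> K \<Longrightarrow> norm (H z) \<le> L"
    by (auto simp: bounded_pos)
  have lip: "norm (egrad f b - egrad f a) \<le> L * norm (b - a)" if "a \<in> K" "b \<in> K" for a b
  proof (rule differentiable_bound[OF K(2)])
    show "(egrad f has_derivative blinfun_apply (H z)) (at z within K)" if "z \<in> K" for z
      using H K(3) that by (auto intro: has_derivative_at_withinI)
    show "onorm (blinfun_apply (H z)) \<le> L" if "z \<in> K" for z
      using L(2)[OF that] by (simp add: norm_blinfun.rep_eq)
  qed (use that in auto)
  have taylor: "\<bar>real_of_ereal (f b) - real_of_ereal (f a) - egrad f a \<bullet> (b - a)\<bar> \<le> L * (norm (b - a))\<^sup>2"
    if ab: "a \<in> K" "b \<in> K" for a b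
  proof -
    define \<gamma> where "\<gamma> t = a + t *\<^sub>R (b - a)" for t
    have \<gamma>: "\<gamma> t \<in> K" if "0 \<le> t" "t \<le> 1" for t
    proof -
      have "\<gamma> t = (1 - t) *\<^sub>R a + t *\<^sub>R b" by (simp add: \<gamma>_def algebra_simps)
      then show ?thesis using K(2) ab that by (auto simp: convex_alt)
    qed
    have "\<exists>t\<in>{0<..<1::real}. real_of_ereal (f (\<gamma> 1)) - real_of_ereal (f (\<gamma> 0)) =
        ((1 - 0) *\<^sub>R (b - a)) \<bullet> egrad f (\<gamma> t)"
    proof (rule mvt_simple)
      fix t :: real assume t: "0 \<le> t" "t \<le> 1"
      have "GDERIV (\<lambda>z. real_of_ereal (f z)) (\<gamma> t) :> egrad f (\<gamma> t)"
        using f K(3) \<gamma>[OF t] by (auto simp: twice_cont_diff_on_def)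
      then have "((\<lambda>z. real_of_ereal (f z)) has_derivative (\<lambda>h. h \<bullet> egrad f (\<gamma> t))) (at (\<gamma> t))"
        by (simp add: gderiv_def)
      moreover have "(\<gamma> has_derivative (\<lambda>h. h *\<^sub>R (b - a))) (at t within {0..1})"
        unfolding \<gamma>_def by (auto intro!: derivative_eq_intros)
      ultimately show "((\<lambda>t. real_of_ereal (f (\<gamma> t))) has_derivative
          (\<lambda>h. (h *\<^sub>R (b - a)) \<bullet> egrad f (\<gamma> t))) (at t within {0..1})"
        by (rule has_derivative_compose[rotated])
    qed simp
    then obtain t where t: "0 < t" "t < 1"
      and eq: "real_of_ereal (f b) - real_of_ereal (f a) = (b - a) \<bullet> egrad f (\<gamma> t)"
      by (auto simp: \<gamma>_def)
    have "\<bar>real_of_ereal (f b) - real_of_ereal (f a) - egrad f a \<bullet> (b - a)\<bar>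
        = \<bar>(egrad f (\<gamma> t) - egrad f a) \<bullet> (b - a)\<bar>"
      unfolding eq by (simp add: inner_diff_left inner_diff_right inner_commute)
    also have "\<dots> \<le> norm (egrad f (\<gamma> t) - egrad f a) * norm (b - a)"
      by (rule Cauchy_Schwarz_ineq2)
    also have "\<dots> \<le> (L * norm (\<gamma> t - a)) * norm (b - a)"
      using t \<gamma>[of t] ab by (intro mult_right_mono lip) auto
    also have "\<dots> \<le> (L * norm (b - a)) * norm (b - a)"
      using t L(1) by (intro mult_right_mono mult_left_mono) (auto simp: \<gamma>_def mult_left_le_one_le)
    finally show ?thesis by (simp add: power2_eq_square mult_ac)
  qed
  show ?thesis by (rule that[OF L(1) lip taylor])
qed

lemma self_adjoint_square_expand:
  assumes "self_adjoint Q"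
  shows "(u + h) \<bullet> Q (u + h) = u \<bullet> Q u + 2 * (Q u \<bullet> h) + h \<bullet> Q h"
  using assms by (simp add: self_adjoint_def blinfun.add_right inner_simps inner_commute)

section \<open>One iteration\<close>

locale composite_problem =
  fixes f g :: "'a::euclidean_space \<Rightarrow> ereal"
  assumes g_proper: "proper_fun g" and g_convex: "econvex g"
    and f_finite: "\<And>z. z \<in> edom g \<Longrightarrow> \<bar>f z\<bar> \<noteq> \<infinity>"
begin

definition fr :: "'a \<Rightarrow> real" where "fr z = real_of_ereal (f z)"
definition gr :: "'a \<Rightarrow> real" where "gr z = real_of_ereal (g z)"
definition Fr :: "'a \<Rightarrow> real" where "Fr z = fr z + gr z"

text \<open>
  The function \<open>Theta f g Q x\<close> without its constant term \<open>f x\<close>.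
\<close>

definition model :: "('a \<Rightarrow>\<^sub>L 'a) \<Rightarrow> 'a \<Rightarrow> 'a \<Rightarrow> real" where
  "model Q x z = egrad f x \<bullet> (z - x) + 1 / 2 * ((z - x) \<bullet> Q (z - x)) + gr z"

lemma g_not_MInf: "g z \<noteq> - \<infinity>"
  using g_proper by (simp add: proper_fun_def)

lemma f_eq: "z \<in> edom g \<Longrightarrow> f z = ereal (fr z)"
  using f_finite by (auto simp: fr_def ereal_real)

lemma g_finite: "z \<in> edom g \<Longrightarrow> \<bar>g z\<bar> \<noteq> \<infinity>"
  using g_not_MInf[of z] by (auto simp: edom_def)

lemma g_eq: "z \<in> edom g \<Longrightarrow> g z = ereal (gr z)"
  using g_finite by (auto simp: gr_def ereal_real)

lemma composite_eq: "z \<in> edom g \<Longrightarrow> composite f g z = ereal (Fr z)"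
  by (simp add: composite_def f_eq g_eq Fr_def)

lemma Theta_eq: "x \<in> edom g \<Longrightarrow> z \<in> edom g \<Longrightarrow> Theta f g Q x z = ereal (fr x + model Q x z)"
  by (simp add: Theta_def f_eq g_eq model_def)

lemma Theta_finite_dom: "x \<in> edom g \<Longrightarrow> Theta f g Q x z < \<infinity> \<Longrightarrow> z \<in> edom g"
  using g_not_MInf[of z] by (auto simp: Theta_def f_eq edom_def)

lemma segment_in_dom:
  assumes "x \<in> edom g" "y \<in> edom g" "0 \<le> t" "t \<le> 1"
  shows "x + t *\<^sub>R (y - x) \<in> edom g"
proof -
  have "x + t *\<^sub>R (y - x) = (1 - t) *\<^sub>R x + t *\<^sub>R y"
    by (simp add: algebra_simps)
  then show ?thesis
    using convex_edom[OF g_convex] assms by (auto simp: convex_alt)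
qed

lemma gr_convex:
  assumes "x \<in> edom g" "y \<in> edom g" "0 \<le> t" "t \<le> 1"
  shows "gr (x + t *\<^sub>R (y - x)) \<le> gr x + t * (gr y - gr x)"
proof -
  have z: "x + t *\<^sub>R (y - x) = (1 - t) *\<^sub>R x + t *\<^sub>R y"
    by (simp add: algebra_simps)
  have "g (x + t *\<^sub>R (y - x)) \<le> ereal (1 - t) * g x + ereal t * g y"
    using g_convex assms unfolding z by (auto simp: econvex_def)
  then show ?thesis
    using g_eq[OF assms(1)] g_eq[OF assms(2)] g_eq[OF segment_in_dom[OF assms]]
    by (simp add: algebra_simps)
qed

lemma model_expand:
  assumes "self_adjoint Q"
  shows "model Q x z - model Q x z0 =
    gr z - gr z0 + (egrad f x + Q (z0 - x)) \<bullet> (z - z0) + 1 / 2 * ((z - z0) \<bullet> Q (z - z0))"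
proof -
  have "(z - x) \<bullet> Q (z - x) =
      (z0 - x) \<bullet> Q (z0 - x) + 2 * (Q (z0 - x) \<bullet> (z - z0)) + (z - z0) \<bullet> Q (z - z0)"
    using self_adjoint_square_expand[OF assms, of "z0 - x" "z - z0"] by simp
  moreover have "egrad f x \<bullet> (z - x) = egrad f x \<bullet> (z0 - x) + egrad f x \<bullet> (z - z0)"
    by (simp add: inner_simps)
  ultimately show ?thesis
    unfolding model_def by (simp add: inner_add_left field_simps)
qed

text \<open>
  Fermat's rule for the subproblem. Comparing the minimiser with the points of a segment of
  parameter \<open>t\<close> towards \<open>u\<close> costs a quadratic term of order \<open>t\<^sup>2\<close> while everything else is at
  most linear in \<open>t\<close>, so the quadratic term disappears after division by \<open>t\<close> and \<open>t \<longlongrightarrow> 0\<close>.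
\<close>

lemma model_minimiser_subgradient:
  assumes Q: "self_adjoint Q" and xb: "xb \<in> edom g"
    and min: "\<And>z. z \<in> edom g \<Longrightarrow> model Q x xb \<le> model Q x z"
  shows "convex_subgradient g xb (- (egrad f x + Q (xb - x)))"
  unfolding convex_subgradient_def
proof
  fix u
  define c where "c = egrad f x + Q (xb - x)"
  show "g xb + ereal (- (egrad f x + Q (xb - x)) \<bullet> (u - xb)) \<le> g u"
  proof (cases "u \<in> edom g")
    case False
    then show ?thesis by (simp add: edom_def)
  next
    case True
    define w where "w = gr u - gr xb + c \<bullet> (u - xb)"
    define q where "q = 1 / 2 * ((u - xb) \<bullet> Q (u - xb))"
    have *: "0 \<le> w + t * q" if t: "0 < t" "t < 1" for t
    proof -
      have "0 \<le> model Q x (xb + t *\<^sub>R (u - xb)) - model Q x xb"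
        using min[OF segment_in_dom[OF xb True]] t by simp
      also have "\<dots> = gr (xb + t *\<^sub>R (u - xb)) - gr xb + t * (c \<bullet> (u - xb)) + t * (t * q)"
        by (simp add: model_expand[OF Q] c_def q_def blinfun.scaleR_right)
      also have "\<dots> \<le> t * (w + t * q)"
        using gr_convex[OF xb True, of t] t by (simp add: w_def algebra_simps)
      finally show ?thesis
        using t by (simp add: zero_le_mult_iff)
    qed
    have "0 \<le> w"
    proof (rule tendsto_lowerbound)
      have "((\<lambda>t. w + t * q) \<longlongrightarrow> w + 0 * q) (at_right 0)"
        by (intro tendsto_intros)
      then show "((\<lambda>t. w + t * q) \<longlongrightarrow> w) (at_right 0)" by simp
      show "\<forall>\<^sub>F t in at_right 0. 0 \<le> w + t * q"
        using * by (intro eventually_mono[OF eventually_at_right_real[of 0 1]]) auto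
    qed simp
    then show ?thesis
      by (simp add: g_eq[OF xb] g_eq[OF True] w_def c_def inner_simps)
  qed
qed

text \<open>
  One iteration in terms of real numbers: \<open>xb\<close> is the exact minimiser of the subproblem and
  \<open>m\<close> the line-search exponent. Strong convexity of the subproblem appears as the quadratic
  growth of the model away from \<open>xb\<close>. The choice between \<open>y\<close> and the line-search point enters
  through its consequences that \<open>x'\<close> is no worse than \<open>y\<close>, inherits the line-search decrease,
  and is at most as far from \<open>x\<close> as \<open>y\<close>.
\<close>

lemma vmipg_stepE:
  assumes step: "vmipg_step f g \<mu> \<beta> \<sigma> e Q x y x'" and x: "x \<in> edom g"
    and \<beta>: "0 < \<beta>" "\<beta> < 1"
  obtains xb m where
    "y \<in> edom g" "xb \<in> edom g" "x' \<in> edom g"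
    "\<And>v. \<mu> * (norm v)\<^sup>2 \<le> v \<bullet> Q v"
    "model Q x y < gr x"
    "convex_subgradient g xb (- (egrad f x + Q (xb - x)))"
    "\<mu> / 2 * (norm (y - xb))\<^sup>2 \<le> model Q x y - model Q x xb"
    "model Q x y - model Q x xb \<le> e * (norm (y - x))\<^sup>2"
    "norm (x' - x) \<le> norm (y - x)"
    "Fr x' \<le> Fr y"
    "\<sigma> * \<beta> ^ m * (norm (y - x))\<^sup>2 \<le> Fr x - Fr x'"
    "\<And>j. j < m \<Longrightarrow> Fr x - Fr (x + \<beta> ^ j *\<^sub>R (y - x)) < \<sigma> * \<beta> ^ j * (norm (y - x))\<^sup>2"
proof -
  define d where "d = y - x"
  from step obtain xb m where
    Q: "self_adjoint Q" "loewner_ge Q (\<mu> *\<^sub>R id_blinfun)"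
    and less: "Theta f g Q x y < Theta f g Q x x"
    and min: "\<And>z. Theta f g Q x xb \<le> Theta f g Q x z"
    and inexact: "Theta f g Q x y - Theta f g Q x xb \<le> ereal (e * (norm (y - x))\<^sup>2)"
    and m: "sufficient_decrease (composite f g) \<beta> \<sigma> x d m"
    and m_min: "\<And>j. j < m \<Longrightarrow> \<not> sufficient_decrease (composite f g) \<beta> \<sigma> x d j"
    and x': "x' = (if composite f g y < composite f g (x + \<beta> ^ m *\<^sub>R d) then y else x + \<beta> ^ m *\<^sub>R d)"
    unfolding vmipg_step_def Let_def is_arg_min_def d_def by (force simp: not_less)
  have coercive: "\<mu> * (norm v)\<^sup>2 \<le> v \<bullet> Q v" for v
    using Q(2) by (simp add: loewner_ge_def blinfun.diff_left blinfun.scaleR_left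
        inner_diff_right dot_square_norm)
  have y: "y \<in> edom g"
    using Theta_finite_dom[OF x] less Theta_eq[OF x x] by (metis ereal_less(1) less_ereal.simps(4) order.strict_trans)
  have xb: "xb \<in> edom g"
    using Theta_finite_dom[OF x, of Q xb] min[of x] Theta_eq[OF x x] by (metis ereal_infty_less(1) ereal_infty_less_eq(1) PInfty_neq_ereal(1))
  have ray: "x + \<beta> ^ j *\<^sub>R d \<in> edom g" for j
    unfolding d_def using \<beta> by (intro segment_in_dom x y) (auto intro: power_le_one)
  have dec_iff: "sufficient_decrease (composite f g) \<beta> \<sigma> x d j \<longleftrightarrow>
      \<sigma> * \<beta> ^ j * (norm d)\<^sup>2 \<le> Fr x - Fr (x + \<beta> ^ j *\<^sub>R d)" for j
    using x ray[of j] by (simp add: sufficient_decrease_def composite_eq)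
  have x'_eq: "x' = (if Fr y < Fr (x + \<beta> ^ m *\<^sub>R d) then y else x + \<beta> ^ m *\<^sub>R d)"
    using x' y ray[of m] by (simp add: composite_eq)
  have min': "model Q x xb \<le> model Q x z" if "z \<in> edom g" for z
    using min[of z] Theta_eq[OF x xb] Theta_eq[OF x that] by simp
  have sub: "convex_subgradient g xb (- (egrad f x + Q (xb - x)))"
    by (rule model_minimiser_subgradient[OF Q(1) xb min'])
  have strong: "\<mu> / 2 * (norm (y - xb))\<^sup>2 \<le> model Q x y - model Q x xb"
  proof -
    have "g xb + ereal (- (egrad f x + Q (xb - x)) \<bullet> (y - xb)) \<le> g y"
      using sub unfolding convex_subgradient_def by blast
    then have "gr xb - (egrad f x + Q (xb - x)) \<bullet> (y - xb) \<le> gr y"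
      unfolding g_eq[OF y] g_eq[OF xb] by (simp add: inner_simps)
    then show ?thesis
      using coercive[of "y - xb"] unfolding model_expand[OF Q(1)] by linarith
  qed
  show ?thesis
  proof (rule that[of xb m])
    show "x' \<in> edom g" using x'_eq y ray by simp
    show "model Q x y < gr x"
      using less Theta_eq[OF x y] Theta_eq[OF x x] by (simp add: model_def)
    show "model Q x y - model Q x xb \<le> e * (norm (y - x))\<^sup>2"
      using inexact Theta_eq[OF x y] Theta_eq[OF x xb] by simp
    have "norm (\<beta> ^ m *\<^sub>R d) \<le> norm d"
      using \<beta> by (simp add: mult_left_le_one_le power_le_one)
    then show "norm (x' - x) \<le> norm (y - x)"
      using x'_eq by (simp add: d_def)
    show "Fr x' \<le> Fr y" using x'_eq by simp
    show "\<sigma> * \<beta> ^ m * (norm (y - x))\<^sup>2 \<le> Fr x - Fr x'"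
      using m x'_eq unfolding dec_iff by (auto simp: d_def)
    show "Fr x - Fr (x + \<beta> ^ j *\<^sub>R (y - x)) < \<sigma> * \<beta> ^ j * (norm (y - x))\<^sup>2" if "j < m" for j
      using m_min[OF that] unfolding dec_iff by (simp add: d_def)
  qed (fact y xb coercive sub strong)+
qed

end

section \<open>Estimates along a run\<close>

text \<open>
  A whole run, described by the real inequalities that one iteration provides, for a
  common bound \<open>\<epsilon>b\<close> on the inexactness parameters.
\<close>

locale inexact_prox_run = composite_problem f g
  for f g :: "'a::euclidean_space \<Rightarrow> ereal" +
  fixes \<O> :: "'a set" and \<mu> \<beta> \<sigma> \<mu>b \<epsilon>b Fmin :: real
    and Q :: "nat \<Rightarrow> 'a \<Rightarrow>\<^sub>L 'a" and x y xb :: "nat \<Rightarrow> 'a" and m :: "nat \<Rightarrow> nat"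
  assumes g_lsc: "lsc g" and g_cont: "continuous_on (edom g) g"
    and O_open: "open \<O>" and O_dom: "closure (edom g) \<subseteq> \<O>"
    and f_C2: "twice_cont_diff_on f \<O>"
    and Fmin: "\<And>z. z \<in> edom g \<Longrightarrow> Fmin \<le> Fr z"
    and \<mu>: "0 < \<mu>" and \<beta>: "0 < \<beta>" "\<beta> < 1" and \<sigma>: "0 < \<sigma>" "\<sigma> < \<mu> / 2" and \<epsilon>b: "0 < \<epsilon>b"
    and x_dom: "\<And>k. x k \<in> edom g" and y_dom: "\<And>k. y k \<in> edom g" and xb_dom: "\<And>k. xb k \<in> edom g"
    and x_bounded: "bounded (range x)"
    and Q_coercive: "\<And>k v. \<mu> * (norm v)\<^sup>2 \<le> v \<bullet> Q k v" and Q_norm: "\<And>k. norm (Q k) \<le> \<mu>b"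
    and model_decrease: "\<And>k. model (Q k) (x k) (y k) < gr (x k)"
    and xb_subgradient: "\<And>k. convex_subgradient g (xb k) (- (egrad f (x k) + Q k (xb k - x k)))"
    and model_growth: "\<And>k. \<mu> / 2 * (norm (y k - xb k))\<^sup>2 \<le> model (Q k) (x k) (y k) - model (Q k) (x k) (xb k)"
    and inexactness: "\<And>k. model (Q k) (x k) (y k) - model (Q k) (x k) (xb k) \<le> \<epsilon>b * (norm (y k - x k))\<^sup>2"
    and step_le: "\<And>k. norm (x (Suc k) - x k) \<le> norm (y k - x k)"
    and next_le_y: "\<And>k. Fr (x (Suc k)) \<le> Fr (y k)"
    and armijo: "\<And>k. \<sigma> * \<beta> ^ m k * (norm (y k - x k))\<^sup>2 \<le> Fr (x k) - Fr (x (Suc k))"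
    and armijo_fails: "\<And>k j. j < m k \<Longrightarrow>
      Fr (x k) - Fr (x k + \<beta> ^ j *\<^sub>R (y k - x k)) < \<sigma> * \<beta> ^ j * (norm (y k - x k))\<^sup>2"
begin

definition D :: "nat \<Rightarrow> real" where "D k = norm (y k - x k)"

lemma D_pos: "0 < D k"
proof -
  have "y k \<noteq> x k"
    using model_decrease[of k] by (auto simp: model_def)
  then show ?thesis by (simp add: D_def)
qed

lemma dom_in_O: "edom g \<subseteq> \<O>"
  using closure_subset O_dom by blast

lemma Fr_antimono: "k \<le> n \<Longrightarrow> Fr (x n) \<le> Fr (x k)"
proof (rule lift_Suc_antimono_le[of "\<lambda>k. Fr (x k)"])
  fix k
  have "0 \<le> \<sigma> * \<beta> ^ m k * (norm (y k - x k))\<^sup>2"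
    using \<sigma> \<beta> by simp
  with armijo[of k] show "Fr (x (Suc k)) \<le> Fr (x k)" by linarith
qed

lemma fr_continuous: "continuous_on \<O> fr"
proof (rule differentiable_imp_continuous_on)
  show "fr differentiable_on \<O>"
    using f_C2 unfolding differentiable_on_def differentiable_def twice_cont_diff_on_def fr_def gderiv_def
    by (blast intro: has_derivative_at_withinI)
qed

lemma egrad_continuous: "continuous_on \<O> (egrad f)"
proof (rule differentiable_imp_continuous_on)
  show "egrad f differentiable_on \<O>"
    using f_C2 unfolding differentiable_on_def differentiable_def twice_cont_diff_on_def
    by (blast intro: has_derivative_at_withinI)
qed

lemma gr_continuous: "continuous_on (edom g) gr"
  using g_cont continuous_on_iff_real[of "edom g" g] g_finite
  by (simp add: gr_def[abs_def] comp_def)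

lemma Fr_continuous: "continuous_on (edom g) Fr"
  unfolding Fr_def[abs_def]
  by (intro continuous_on_add gr_continuous continuous_on_subset[OF fr_continuous dom_in_O])

lemma bounded_image_of_iterates:
  fixes h :: "'a \<Rightarrow> 'b::real_normed_vector"
  assumes "continuous_on \<O> h"
  obtains B where "0 < B" "\<And>k. norm (h (x k)) \<le> B"
proof -
  have "compact (closure (range x))"
    using x_bounded by (simp add: compact_closure)
  moreover have "closure (range x) \<subseteq> \<O>"
    using closure_mono[of "range x" "edom g"] x_dom O_dom by blast
  ultimately have "bounded (h ` closure (range x))"
    using assms by (intro compact_imp_bounded compact_continuous_image) (auto intro: continuous_on_subset)
  then obtain B where "0 < B" "\<And>z. z \<in> closure (range x) \<Longrightarrow> norm (h z) \<le> B"
    by (auto simp: bounded_pos)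
  then show ?thesis
    using that[of B] closure_subset[of "range x"] by blast
qed

lemma gr_iterates_bounded: obtains B where "\<And>k. gr (x k) \<le> B"
proof -
  obtain Bf where Bf: "\<And>k. norm (fr (x k)) \<le> Bf"
    using bounded_image_of_iterates[OF fr_continuous] by blast
  have "gr (x k) \<le> Fr (x 0) + Bf" for k
    using Fr_antimono[of 0 k] Bf[of k] by (simp add: Fr_def)
  then show ?thesis by (rule that)
qed

text \<open>
  A subgradient of \<open>g\<close> at \<open>xb 0\<close> is an affine minorant of \<open>g\<close>. Hence the model is bounded below
  along the step by a coercive quadratic whose lower-order coefficients are uniform in \<open>k\<close>,
  while the model decreases: long steps are impossible.
\<close>

lemma D_bounded: obtains R where "\<And>k. D k \<le> R"
proof -
  define v0 where "v0 = - (egrad f (x 0) + Q 0 (xb 0 - x 0))"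
  obtain Bg where Bg: "0 < Bg" "\<And>k. norm (egrad f (x k)) \<le> Bg"
    using bounded_image_of_iterates[OF egrad_continuous] by blast
  obtain Bx where Bx: "0 < Bx" "\<And>k. norm (x k) \<le> Bx"
    using bounded_image_of_iterates[of id] by auto
  obtain B where B: "\<And>k. gr (x k) \<le> B"
    using gr_iterates_bounded by blast
  define B1 where "B1 = \<bar>B - gr (xb 0) + norm v0 * (Bx + norm (xb 0))\<bar>"
  define B2 where "B2 = Bg + norm v0"
  show ?thesis
  proof
    fix k
    define d where "d = y k - x k"
    have "g (xb 0) + ereal (v0 \<bullet> (y k - xb 0)) \<le> g (y k)"
      using xb_subgradient[of 0] unfolding convex_subgradient_def v0_def by blast
    then have "gr (xb 0) + v0 \<bullet> (y k - xb 0) \<le> gr (y k)"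
      by (simp add: g_eq[OF y_dom] g_eq[OF xb_dom])
    moreover have "v0 \<bullet> (y k - xb 0) = v0 \<bullet> (x k - xb 0) + v0 \<bullet> d"
      by (simp add: d_def inner_simps)
    moreover have "- (norm v0 * norm d) \<le> v0 \<bullet> d"
      using Cauchy_Schwarz_ineq2[of v0 d] by linarith
    moreover have "- (norm v0 * (Bx + norm (xb 0))) \<le> v0 \<bullet> (x k - xb 0)"
    proof -
      have "norm v0 * norm (x k - xb 0) \<le> norm v0 * (Bx + norm (xb 0))"
        using norm_triangle_ineq4[of "x k" "xb 0"] Bx(2)[of k] by (intro mult_left_mono) auto
      then show ?thesis using Cauchy_Schwarz_ineq2[of v0 "x k - xb 0"] by linarith
    qed
    moreover have "egrad f (x k) \<bullet> d + 1 / 2 * (d \<bullet> Q k d) + gr (y k) < gr (x k)"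
      using model_decrease[of k] by (simp add: model_def d_def)
    moreover have "- (Bg * norm d) \<le> egrad f (x k) \<bullet> d"
    proof -
      have "norm (egrad f (x k)) * norm d \<le> Bg * norm d"
        using Bg(2) by (intro mult_right_mono) auto
      then show ?thesis using Cauchy_Schwarz_ineq2[of "egrad f (x k)" d] by linarith
    qed
    ultimately have quad: "\<mu> / 2 * (norm d)\<^sup>2 \<le> B2 * norm d + B1"
      using Q_coercive[of d k] B[of k] unfolding B1_def B2_def distrib_right by linarith
    have "norm d \<le> 2 * (B2 + B1) / \<mu>" if "1 \<le> norm d"
    proof -
      have "B1 * 1 \<le> B1 * norm d"
        using that by (intro mult_left_mono) (auto simp: B1_def)
      with quad have "(\<mu> / 2 * norm d) * norm d \<le> (B2 + B1) * norm d"
        by (simp add: power2_eq_square algebra_simps)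
      then have "\<mu> / 2 * norm d \<le> B2 + B1"
        using that by (smt (verit) mult_right_le_imp_le)
      then show ?thesis using \<mu> by (simp add: field_simps)
    qed
    then show "D k \<le> max 1 (2 * (B2 + B1) / \<mu>)"
      unfolding D_def d_def by linarith
  qed
qed

text \<open>
  \<open>sqrt (2 * \<epsilon>b / \<mu>)\<close> bounds the distance from \<open>y k\<close> to \<open>xb k\<close>, and 1 that from \<open>x k\<close> to \<open>y k\<close>, in
  units of the step length \<open>D k\<close>.
\<close>

definition \<kappa> :: real where "\<kappa> = 1 + sqrt (2 * \<epsilon>b / \<mu>)"

lemma \<kappa>_ge: "1 \<le> \<kappa>"
  using \<mu> \<epsilon>b by (simp add: \<kappa>_def)

text \<open>
  Quadratic growth bounds the distance from \<open>y k\<close> to \<open>xb k\<close> by the inexactness, which is measured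
  relative to the step length.
\<close>

lemma xb_close: "norm (xb k - x k) \<le> \<kappa> * D k"
proof -
  have "\<mu> / 2 * (norm (y k - xb k))\<^sup>2 \<le> \<epsilon>b * (D k)\<^sup>2"
    using model_growth[of k] inexactness[of k] by (simp add: D_def)
  then have "(norm (y k - xb k))\<^sup>2 \<le> (2 * \<epsilon>b / \<mu>) * (D k)\<^sup>2"
    using \<mu> by (simp add: field_simps)
  also have "\<dots> = (sqrt (2 * \<epsilon>b / \<mu>) * D k)\<^sup>2"
    using \<mu> \<epsilon>b by (simp add: power_mult_distrib)
  finally have "norm (y k - xb k) \<le> sqrt (2 * \<epsilon>b / \<mu>) * D k"
    using \<mu> \<epsilon>b D_pos[of k] by (intro power2_le_imp_le[of "norm (y k - xb k)"]) auto
  moreover have "norm (xb k - x k) \<le> norm (y k - xb k) + D k"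
    using norm_triangle_ineq[of "xb k - y k" "y k - x k"] by (simp add: D_def norm_minus_commute)
  ultimately show ?thesis by (simp add: \<kappa>_def algebra_simps)
qed

text \<open>
  All points of interest lie in the closed convex hull of the bounded sequences \<open>x\<close>, \<open>y\<close> and \<open>xb\<close>.
  It is compact and contained in the closure of the domain of \<open>g\<close>, hence in \<open>\<O>\<close>.
\<close>

lemma smoothness_along_run:
  obtains L where "0 < L"
    "\<And>k. norm (egrad f (xb k) - egrad f (x k)) \<le> L * norm (xb k - x k)"
    "\<And>k. \<bar>fr (xb k) - fr (x k) - egrad f (x k) \<bullet> (xb k - x k)\<bar> \<le> L * (norm (xb k - x k))\<^sup>2"
    "\<And>k t. 0 \<le> t \<Longrightarrow> t \<le> 1 \<Longrightarrow>
       \<bar>fr (x k + t *\<^sub>R (y k - x k)) - fr (x k) - egrad f (x k) \<bullet> (t *\<^sub>R (y k - x k))\<bar>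
         \<le> L * (t * D k)\<^sup>2"
proof -
  obtain R where R: "\<And>k. D k \<le> R" using D_bounded by blast
  obtain Bx where Bx: "\<And>k. norm (x k) \<le> Bx"
    using x_bounded by (auto simp: bounded_iff)
  have "norm (y k) \<le> Bx + R" for k
    using norm_triangle_ineq[of "x k" "y k - x k"] Bx[of k] R[of k] by (simp add: D_def)
  then have y_bdd: "bounded (range y)" by (auto simp: bounded_iff)
  have "norm (xb k) \<le> Bx + \<kappa> * R" for k
  proof -
    have "\<kappa> * D k \<le> \<kappa> * R" using R[of k] \<kappa>_ge by (intro mult_left_mono) auto
    then show ?thesis
      using norm_triangle_ineq[of "x k" "xb k - x k"] Bx[of k] xb_close[of k] by simp
  qed
  then have bxb: "bounded (range xb)" by (auto simp: bounded_iff)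
  define P where "P = range x \<union> range y \<union> range xb"
  define K where "K = closure (convex hull P)"
  have "bounded P" using x_bounded y_bdd bxb by (simp add: P_def)
  then have "compact K"
    by (simp add: K_def compact_closure bounded_convex_hull)
  moreover have "convex K"
    by (simp add: K_def convex_closure)
  moreover have "convex hull P \<subseteq> edom g"
    using x_dom y_dom xb_dom by (intro hull_minimal convex_edom[OF g_convex]) (auto simp: P_def)
  then have "K \<subseteq> \<O>"
    using closure_mono O_dom unfolding K_def by blast
  ultimately obtain L where L: "0 < L"
    "\<And>a b. a \<in> K \<Longrightarrow> b \<in> K \<Longrightarrow> norm (egrad f b - egrad f a) \<le> L * norm (b - a)"
    "\<And>a b. a \<in> K \<Longrightarrow> b \<in> K \<Longrightarrow> \<bar>fr b - fr a - egrad f a \<bullet> (b - a)\<bar> \<le> L * (norm (b - a))\<^sup>2"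
    using C1_bounds_on_compact_convex[OF f_C2, of K] unfolding fr_def by blast
  have "P \<subseteq> K"
    unfolding K_def by (rule subset_trans[OF hull_subset closure_subset])
  then have in_K: "x k \<in> K" "y k \<in> K" "xb k \<in> K" for k
    by (auto simp: P_def)
  show ?thesis
  proof (rule that[OF L(1) L(2)[OF in_K(1) in_K(3)] L(3)[OF in_K(1) in_K(3)]])
    fix k and t :: real assume t: "0 \<le> t" "t \<le> 1"
    have "x k + t *\<^sub>R (y k - x k) = (1 - t) *\<^sub>R x k + t *\<^sub>R y k"
      by (simp add: algebra_simps)
    then have "x k + t *\<^sub>R (y k - x k) \<in> K"
      using \<open>convex K\<close> in_K t by (auto simp: convex_alt)
    from L(3)[OF in_K(1) this, of k]
    show "\<bar>fr (x k + t *\<^sub>R (y k - x k)) - fr (x k) - egrad f (x k) \<bullet> (t *\<^sub>R (y k - x k))\<bar>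
         \<le> L * (t * D k)\<^sup>2"
      using t by (simp add: D_def power_mult_distrib)
  qed
qed

text \<open>
  Along the step the linear part of the model decreases at rate at least \<open>\<mu> / 2 * (D k)\<^sup>2\<close>, since
  the quadratic part is at least that large. As \<open>\<sigma> < \<mu> / 2\<close>, the Taylor remainder is absorbed for
  every step size up to a threshold \<open>\<tau>\<close> independent of \<open>k\<close>. Backtracking therefore never
  goes below \<open>min 1 (\<beta> * \<tau>)\<close>.
\<close>

lemma sufficient_descent:
  obtains a where "0 < a" "\<And>k. a * (D k)\<^sup>2 \<le> Fr (x k) - Fr (x (Suc k))"
proof -
  obtain L where L: "0 < L" and taylor: "\<And>k t. 0 \<le> t \<Longrightarrow> t \<le> 1 \<Longrightarrow>
       \<bar>fr (x k + t *\<^sub>R (y k - x k)) - fr (x k) - egrad f (x k) \<bullet> (t *\<^sub>R (y k - x k))\<bar>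
         \<le> L * (t * D k)\<^sup>2"
    by (rule smoothness_along_run) blast
  define \<tau> where "\<tau> = (\<mu> / 2 - \<sigma>) / L"
  have \<tau>: "0 < \<tau>" using \<sigma> L by (simp add: \<tau>_def)
  have accept: "\<sigma> * t * (D k)\<^sup>2 \<le> Fr (x k) - Fr (x k + t *\<^sub>R (y k - x k))"
    if t: "0 \<le> t" "t \<le> 1" "t \<le> \<tau>" for t k
  proof -
    define d where "d = y k - x k"
    have "L * t \<le> \<mu> / 2 - \<sigma>"
      using t(3) L by (simp add: \<tau>_def field_simps)
    then have "(L * t) * (t * (D k)\<^sup>2) \<le> (\<mu> / 2 - \<sigma>) * (t * (D k)\<^sup>2)"
      using t by (intro mult_right_mono) auto
    then have 1: "L * (t * D k)\<^sup>2 \<le> \<mu> / 2 * t * (D k)\<^sup>2 - \<sigma> * t * (D k)\<^sup>2"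
      by (simp add: power2_eq_square algebra_simps)
    have "egrad f (x k) \<bullet> d + (gr (y k) - gr (x k)) \<le> - (\<mu> / 2 * (D k)\<^sup>2)"
      using model_decrease[of k] Q_coercive[of d k] by (simp add: model_def d_def D_def)
    then have "t * (egrad f (x k) \<bullet> d + (gr (y k) - gr (x k))) \<le> t * - (\<mu> / 2 * (D k)\<^sup>2)"
      using t by (intro mult_left_mono) auto
    then have 2: "t * (egrad f (x k) \<bullet> d) + t * (gr (y k) - gr (x k)) \<le> - (\<mu> / 2 * t * (D k)\<^sup>2)"
      by (simp add: algebra_simps)
    have "Fr (x k + t *\<^sub>R d) \<le> fr (x k) + t * (egrad f (x k) \<bullet> d) + L * (t * D k)\<^sup>2
        + (gr (x k) + t * (gr (y k) - gr (x k)))"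
      using taylor[OF t(1,2), of k] gr_convex[OF x_dom[of k] y_dom[of k] t(1,2)]
      by (simp add: Fr_def d_def)
    with 1 2 show ?thesis by (simp add: Fr_def d_def)
  qed
  have step_size: "min 1 (\<beta> * \<tau>) \<le> \<beta> ^ m k" for k
  proof (cases "m k")
    case (Suc j)
    have "\<not> \<beta> ^ j \<le> \<tau>"
      using accept[of "\<beta> ^ j" k] armijo_fails[of j k] Suc \<beta>
      by (auto simp: D_def power_le_one not_le [symmetric])
    then have "\<beta> * \<tau> \<le> \<beta> * \<beta> ^ j"
      using \<beta> by (intro mult_left_mono) auto
    then show ?thesis using Suc by simp
  qed simp
  show ?thesis
  proof (rule that[of "\<sigma> * min 1 (\<beta> * \<tau>)"])
    show "0 < \<sigma> * min 1 (\<beta> * \<tau>)" using \<sigma> \<beta> \<tau> by simp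
    show "\<sigma> * min 1 (\<beta> * \<tau>) * (D k)\<^sup>2 \<le> Fr (x k) - Fr (x (Suc k))" for k
    proof -
      have "\<sigma> * min 1 (\<beta> * \<tau>) * (D k)\<^sup>2 \<le> \<sigma> * \<beta> ^ m k * (D k)\<^sup>2"
        using step_size[of k] \<sigma> by (intro mult_right_mono mult_left_mono) auto
      then show ?thesis using armijo[of k] by (simp add: D_def)
    qed
  qed
qed

lemma Q_quadratic_le: "\<bar>v \<bullet> Q k v\<bar> \<le> \<mu>b * (norm v)\<^sup>2"
proof -
  have "\<bar>v \<bullet> Q k v\<bar> \<le> norm v * norm (Q k v)"
    by (rule Cauchy_Schwarz_ineq2)
  also have "\<dots> \<le> norm v * (\<mu>b * norm v)"
    using norm_blinfun[of "Q k" v] mult_right_mono[OF Q_norm[of k] norm_ge_zero[of v]]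
    by (intro mult_left_mono) auto
  finally show ?thesis by (simp add: power2_eq_square mult_ac)
qed

text \<open>
  The Kurdyka-Lojasiewicz inequality is available at \<open>xb k\<close>, where a subgradient is known, whereas
  the values to be estimated are those at the iterates. The comparison passes through \<open>y k\<close>:
  the next iterate is no worse than \<open>y k\<close>, and \<open>y k\<close> is nearly as good as \<open>xb k\<close> for the model,
  which differs from the objective by second-order terms.
\<close>

lemma next_value_le_exact_value:
  obtains C where "0 < C" "\<And>k. Fr (x (Suc k)) \<le> Fr (xb k) + C * (D k)\<^sup>2"
proof -
  obtain L where L: "0 < L"
    and tb: "\<And>k. \<bar>fr (xb k) - fr (x k) - egrad f (x k) \<bullet> (xb k - x k)\<bar> \<le> L * (norm (xb k - x k))\<^sup>2"
    and ty: "\<And>k t. 0 \<le> t \<Longrightarrow> t \<le> 1 \<Longrightarrow>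
       \<bar>fr (x k + t *\<^sub>R (y k - x k)) - fr (x k) - egrad f (x k) \<bullet> (t *\<^sub>R (y k - x k))\<bar>
         \<le> L * (t * D k)\<^sup>2"
    by (rule smoothness_along_run) blast
  have \<mu>b: "0 \<le> \<mu>b" using Q_norm[of 0] norm_ge_zero[of "Q 0"] by linarith
  define C where "C = \<epsilon>b + L + (L + \<mu>b / 2) * \<kappa>\<^sup>2"
  show ?thesis
  proof
    show "0 < C" using \<epsilon>b L \<mu>b by (simp add: C_def add_pos_nonneg)
    fix k
    have y: "fr (y k) \<le> fr (x k) + egrad f (x k) \<bullet> (y k - x k) + L * (D k)\<^sup>2"
      using ty[of 1 k] by simp
    have "(norm (xb k - x k))\<^sup>2 \<le> (\<kappa> * D k)\<^sup>2"
      using xb_close[of k] by (intro power_mono) auto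
    then have "(L + \<mu>b / 2) * (norm (xb k - x k))\<^sup>2 \<le> (L + \<mu>b / 2) * (\<kappa>\<^sup>2 * (D k)\<^sup>2)"
      using L \<mu>b by (intro mult_left_mono) (auto simp: power_mult_distrib)
    moreover have "0 \<le> (y k - x k) \<bullet> Q k (y k - x k)"
      using Q_coercive[of "y k - x k" k] \<mu> by (smt (verit) mult_nonneg_nonneg zero_le_power2)
    ultimately have "Fr (y k) \<le> Fr (xb k) + C * (D k)\<^sup>2"
      using y tb[of k] inexactness[of k] Q_quadratic_le[of "xb k - x k" k]
      unfolding model_def Fr_def C_def D_def distrib_right by (simp add: algebra_simps abs_le_iff)
    then show "Fr (x (Suc k)) \<le> Fr (xb k) + C * (D k)\<^sup>2"
      using next_le_y[of k] by linarith
  qed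
qed

text \<open>
  The subgradient of the objective at \<open>xb k\<close> that optimality in the subproblem provides.
\<close>

definition w :: "nat \<Rightarrow> 'a" where
  "w k = egrad f (xb k) - (egrad f (x k) + Q k (xb k - x k))"

lemma w_regular_subgradient: "w k \<in> regular_subdiff (composite f g) (xb k)"
proof -
  have "xb k \<in> \<O>" using xb_dom dom_in_O by blast
  moreover have "w k = egrad f (xb k) + - (egrad f (x k) + Q k (xb k - x k))"
    by (simp add: w_def)
  ultimately show ?thesis
    using regular_subdiff_composite[OF g_not_MInf g_finite[OF xb_dom] xb_subgradient O_open, of k f
        "egrad f (xb k)"] f_C2
    unfolding twice_cont_diff_on_def by simp
qed

lemma w_small: obtains W where "0 < W" "\<And>k. norm (w k) \<le> W * D k"
proof -
  obtain L where L: "0 < L"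
    and lip: "\<And>k. norm (egrad f (xb k) - egrad f (x k)) \<le> L * norm (xb k - x k)"
    by (rule smoothness_along_run) blast
  have \<mu>b: "0 \<le> \<mu>b" using Q_norm[of 0] norm_ge_zero[of "Q 0"] by linarith
  show ?thesis
  proof (rule that[of "(L + \<mu>b) * \<kappa>"])
    show "0 < (L + \<mu>b) * \<kappa>" using L \<mu>b \<kappa>_ge by simp
    fix k
    have "norm (Q k (xb k - x k)) \<le> \<mu>b * norm (xb k - x k)"
      using norm_blinfun[of "Q k" "xb k - x k"] mult_right_mono[OF Q_norm[of k] norm_ge_zero[of "xb k - x k"]]
      by linarith
    then have "norm (w k) \<le> (L + \<mu>b) * norm (xb k - x k)"
      using norm_triangle_ineq4[of "egrad f (xb k) - egrad f (x k)" "Q k (xb k - x k)"] lip[of k]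
      by (simp add: w_def algebra_simps)
    also have "\<dots> \<le> (L + \<mu>b) * (\<kappa> * D k)"
      using xb_close L \<mu>b by (intro mult_left_mono) auto
    finally show "norm (w k) \<le> (L + \<mu>b) * \<kappa> * D k" by (simp add: mult_ac)
  qed
qed

section \<open>Cluster points\<close>

definition Finf :: real where "Finf = lim (\<lambda>k. Fr (x k))"

lemma Fr_x_tendsto: "(\<lambda>k. Fr (x k)) \<longlonglongrightarrow> Finf" and Finf_le: "Finf \<le> Fr (x k)"
proof -
  obtain l where "(\<lambda>k. Fr (x k)) \<longlonglongrightarrow> l" "\<forall>k. l \<le> Fr (x k)"
    using decseq_convergent[of "\<lambda>k. Fr (x k)" Fmin] Fr_antimono Fmin[OF x_dom]
    by (auto simp: decseq_def)
  then show "(\<lambda>k. Fr (x k)) \<longlonglongrightarrow> Finf" "Finf \<le> Fr (x k)"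
    using limI unfolding Finf_def by metis+
qed

lemma D_tendsto_0: "D \<longlonglongrightarrow> 0"
proof -
  obtain a where a: "0 < a" "\<And>k. a * (D k)\<^sup>2 \<le> Fr (x k) - Fr (x (Suc k))"
    by (rule sufficient_descent) blast
  have "(\<lambda>k. (Fr (x k) - Fr (x (Suc k))) / a) \<longlonglongrightarrow> (Finf - Finf) / a"
    using a(1) Fr_x_tendsto by (intro tendsto_intros LIMSEQ_Suc) auto
  then have "(\<lambda>k. (Fr (x k) - Fr (x (Suc k))) / a) \<longlonglongrightarrow> 0" by simp
  then have "(\<lambda>k. (D k)\<^sup>2) \<longlonglongrightarrow> 0"
    by (rule tendsto_sandwich[rotated 3])
      (use a in \<open>auto simp: field_simps\<close>)
  then have "(\<lambda>k. sqrt ((D k)\<^sup>2)) \<longlonglongrightarrow> sqrt 0"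
    by (intro tendsto_intros)
  then show ?thesis using D_pos by (simp add: less_imp_le)
qed

text \<open>
  Lower semicontinuity keeps cluster points in the domain of \<open>g\<close>, and there continuity relative
  to the domain identifies the value. Since \<open>xb\<close> has the same cluster points as \<open>x\<close> and its
  subgradients vanish, passing to the limit gives stationarity, both for the limiting
  subdifferential of the sum and in the split form that defines the stationary points.
\<close>

lemma cluster_point:
  assumes s: "filterlim s at_top sequentially" and lim: "(\<lambda>n. x (s n)) \<longlonglongrightarrow> z"
  shows "z \<in> edom g" "Fr z = Finf" "(\<lambda>n. xb (s n)) \<longlonglongrightarrow> z" "(\<lambda>n. Fr (xb (s n))) \<longlonglongrightarrow> Finf"
    "0 \<in> limiting_subdiff (composite f g) z" "z \<in> stationary_points f g"
proof -
  obtain B where B: "\<And>k. gr (x k) \<le> B" using gr_iterates_bounded by blast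
  then have "g z \<le> ereal B"
    by (intro lsc_bounded_at_limit[OF g_lsc lim]) (simp add: g_eq[OF x_dom])
  then show z: "z \<in> edom g" by (auto simp: edom_def)
  have "(\<lambda>n. Fr (x (s n))) \<longlonglongrightarrow> Fr z"
    using continuous_on_tendsto_compose[OF Fr_continuous lim z] x_dom by simp
  moreover have "(\<lambda>n. Fr (x (s n))) \<longlonglongrightarrow> Finf"
    using filterlim_compose[OF Fr_x_tendsto s] .
  ultimately show Fz: "Fr z = Finf" by (rule LIMSEQ_unique)
  have Ds: "(\<lambda>n. D (s n)) \<longlonglongrightarrow> 0"
    using filterlim_compose[OF D_tendsto_0 s] .
  have diff: "(\<lambda>n. xb (s n) - x (s n)) \<longlonglongrightarrow> 0"
  proof (rule Lim_null_comparison)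
    show "\<forall>\<^sub>F n in sequentially. norm (xb (s n) - x (s n)) \<le> \<kappa> * D (s n)"
      using xb_close by simp
    show "(\<lambda>n. \<kappa> * D (s n)) \<longlonglongrightarrow> 0"
      using tendsto_mult_right_zero[OF Ds] by simp
  qed
  show xbs: "(\<lambda>n. xb (s n)) \<longlonglongrightarrow> z"
    using tendsto_add[OF diff lim] by simp
  show Fxb: "(\<lambda>n. Fr (xb (s n))) \<longlonglongrightarrow> Finf"
    using continuous_on_tendsto_compose[OF Fr_continuous xbs z] xb_dom Fz by simp
  obtain W where W: "\<And>k. norm (w k) \<le> W * D k" by (rule w_small) blast
  have ws: "(\<lambda>n. w (s n)) \<longlonglongrightarrow> 0"
  proof (rule Lim_null_comparison)
    show "\<forall>\<^sub>F n in sequentially. norm (w (s n)) \<le> W * D (s n)" using W by simp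
    show "(\<lambda>n. W * D (s n)) \<longlonglongrightarrow> 0"
      using tendsto_mult_right_zero[OF Ds] by simp
  qed
  have compxb: "(\<lambda>n. composite f g (xb (s n))) \<longlonglongrightarrow> composite f g z"
    using Fxb by (simp add: composite_eq xb_dom z Fz)
  show "0 \<in> limiting_subdiff (composite f g) z"
    by (rule limiting_subdiffI[OF _ xbs compxb w_regular_subgradient ws]) (simp add: composite_eq[OF z])
  have gxb: "(\<lambda>n. g (xb (s n))) \<longlonglongrightarrow> g z"
    using continuous_on_tendsto_compose[OF g_cont xbs z] xb_dom by simp
  have "z \<in> \<O>" using z dom_in_O by blast
  have "xb k \<in> \<O>" for k using xb_dom dom_in_O by blast
  then have "(\<lambda>n. egrad f (xb (s n))) \<longlonglongrightarrow> egrad f z"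
    using continuous_on_tendsto_compose[OF egrad_continuous xbs \<open>z \<in> \<O>\<close>] by simp
  from tendsto_diff[OF ws this]
  have vs: "(\<lambda>n. - (egrad f (x (s n)) + Q (s n) (xb (s n) - x (s n)))) \<longlonglongrightarrow> - egrad f z"
    by (simp add: w_def)
  have "- egrad f z \<in> limiting_subdiff g z"
    by (rule limiting_subdiffI[OF g_finite[OF z] xbs gxb _ vs])
      (rule convex_subgradient_regular[OF g_not_MInf g_finite[OF xb_dom] xb_subgradient])
  then show "z \<in> stationary_points f g"
    unfolding stationary_points_def by force
qed

section \<open>Error bound and convergence\<close>

text \<open>
  If no constant worked, the indices at which the constants \<open>n\<close> fail would have iterates
  accumulating at some \<open>z\<close>. Near \<open>z\<close> the Kurdyka-Lojasiewicz inequality holds with fixed constants.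
  Applied at \<open>xb k\<close> it bounds the gap there raised to \<open>\<theta>\<close> by \<open>norm (w k)\<close>, of order \<open>D k\<close>, and
  the excess of the next value over the value at \<open>xb k\<close> contributes
  \<open>((D k)\<^sup>2) powr \<theta> \<le> D k\<close> because \<open>1 / 2 \<le> \<theta>\<close> and eventually \<open>D k \<le> 1\<close>.
\<close>

lemma kl_error_bound:
  assumes KL: "KL_function (composite f g) \<theta>" and \<theta>: "1 / 2 \<le> \<theta>" "\<theta> < 1"
  shows "\<exists>C. \<forall>\<^sub>F k in sequentially. (Fr (x (Suc k)) - Finf) powr \<theta> \<le> C * D k"
proof (rule ccontr)
  assume "\<not> ?thesis"
  then have "\<forall>n. \<exists>k\<ge>n. real n * D k < (Fr (x (Suc k)) - Finf) powr \<theta>"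
    by (auto simp: eventually_sequentially not_le)
  then obtain k where k: "\<And>n. n \<le> k n"
    and fails: "\<And>n. real n * D (k n) < (Fr (x (Suc (k n))) - Finf) powr \<theta>"
    by metis
  have "bounded (range (\<lambda>n. x (k n)))"
    using x_bounded by (rule bounded_subset) auto
  then obtain z t where t: "strict_mono (t :: nat \<Rightarrow> nat)" and lim: "((\<lambda>n. x (k n)) \<circ> t) \<longlonglongrightarrow> z"
    using bounded_imp_convergent_subsequence by blast
  define s where "s n = k (t n)" for n
  have s_ge: "n \<le> t n" "t n \<le> s n" for n
    using seq_suble[OF t] k by (auto simp: s_def)
  have s: "filterlim s at_top sequentially"
    by (rule filterlim_at_top_mono[OF filterlim_ident])
      (use s_ge in \<open>auto intro!: always_eventually intro: order_trans\<close>)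
  have "(\<lambda>n. x (s n)) \<longlonglongrightarrow> z"
    using lim by (simp add: s_def comp_def)
  note cl = cluster_point[OF s this]
  have "KL_at (composite f g) \<theta> z"
    using KL cl(5) unfolding KL_function_def subdiff_dom_def by blast
  then obtain \<delta> \<omega> c where pos: "0 < \<delta>" "0 < (\<omega>::ereal)" "0 < c"
    and kl: "\<And>u v s. u \<in> cball z \<delta> \<Longrightarrow> composite f g u - composite f g z = ereal s \<Longrightarrow>
       composite f g z < composite f g u \<Longrightarrow> composite f g u < composite f g z + \<omega> \<Longrightarrow> 0 < s \<Longrightarrow>
       v \<in> limiting_subdiff (composite f g) u \<Longrightarrow> s powr \<theta> \<le> c * norm v"
    using KL_at_real[of "composite f g" \<theta> z] \<theta> by blast
  obtain W where W: "0 < W" "\<And>k. norm (w k) \<le> W * D k" using w_small by blast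
  obtain C where C: "0 < C" "\<And>k. Fr (x (Suc k)) \<le> Fr (xb k) + C * (D k)\<^sup>2"
    using next_value_le_exact_value by blast
  define M where "M = 2 * (c * W + C powr \<theta>)"
  have near_cluster: "(Fr (x (Suc j)) - Finf) powr \<theta> \<le> M * D j"
    if near: "xb j \<in> cball z \<delta>" "composite f g (xb j) < composite f g z + \<omega>" and Dj: "D j \<le> 1" for j
  proof -
    \<comment> \<open>The exact minimisers may have values below the limit value \<open>Finf\<close>, where the inequality says
      nothing; the gap then counts as 0 and only the second-order term remains.\<close>
    define p where "p = max 0 (Fr (xb j) - Finf)"
    have "p powr \<theta> \<le> c * W * D j"
    proof (cases "Finf < Fr (xb j)")
      case True
      have "p powr \<theta> \<le> c * norm (w j)"
      proof (rule kl[OF near(1) _ _ near(2)])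
        show "composite f g (xb j) - composite f g z = ereal p"
          using True by (simp add: composite_eq xb_dom cl p_def)
        show "composite f g z < composite f g (xb j)"
          using True by (simp add: composite_eq xb_dom cl)
        show "0 < p" using True by (simp add: p_def)
        show "w j \<in> limiting_subdiff (composite f g) (xb j)"
          by (rule limiting_subdiffI[OF _ tendsto_const tendsto_const w_regular_subgradient tendsto_const])
            (simp add: composite_eq[OF xb_dom])
      qed
      also have "\<dots> \<le> c * (W * D j)"
        using W(2) pos by (intro mult_left_mono) auto
      finally show ?thesis by simp
    next
      case False
      then show ?thesis using pos W(1) D_pos[of j] by (simp add: p_def)
    qed
    moreover have "(C * (D j)\<^sup>2) powr \<theta> \<le> C powr \<theta> * D j"
    proof -
      have "((D j)\<^sup>2) powr \<theta> = D j powr (2 * \<theta>)"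
        using D_pos[of j] by (simp add: powr_powr [symmetric] powr_numeral)
      also have "\<dots> \<le> D j powr 1"
        using D_pos[of j] Dj \<theta> by (intro powr_mono') auto
      finally show ?thesis
        using C(1) D_pos[of j] by (simp add: powr_mult)
    qed
    moreover have "(Fr (x (Suc j)) - Finf) powr \<theta> \<le> (p + C * (D j)\<^sup>2) powr \<theta>"
      using C(2)[of j] Finf_le[of "Suc j"] \<theta> by (intro powr_mono2) (auto simp: p_def)
    moreover have "(p + C * (D j)\<^sup>2) powr \<theta> \<le> 2 * (p powr \<theta> + (C * (D j)\<^sup>2) powr \<theta>)"
      using C(1) \<theta> by (intro powr_sum_le) (auto simp: p_def)
    ultimately show ?thesis
      unfolding M_def by (simp add: algebra_simps)
  qed
  have "\<forall>\<^sub>F n in sequentially. dist (xb (s n)) z < \<delta>"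
    using cl(3) pos(1) by (rule tendstoD)
  moreover have "\<forall>\<^sub>F n in sequentially. composite f g (xb (s n)) < composite f g z + \<omega>"
  proof (rule order_tendstoD)
    show "(\<lambda>n. composite f g (xb (s n))) \<longlonglongrightarrow> composite f g z"
      using cl by (simp add: composite_eq xb_dom)
    show "composite f g z < composite f g z + \<omega>"
      using pos(2) by (cases \<omega>) (auto simp: composite_eq[OF cl(1)])
  qed
  moreover have "\<forall>\<^sub>F n in sequentially. D (s n) < 1"
    using filterlim_compose[OF D_tendsto_0 s] by (rule order_tendstoD) simp
  moreover have "\<forall>\<^sub>F n in sequentially. M \<le> real n"
    using eventually_ge_at_top[of "nat \<lceil>M\<rceil>"] by eventually_elim linarith
  ultimately have "\<forall>\<^sub>F n in sequentially. False"
  proof eventually_elim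
    case (elim n)
    have "(Fr (x (Suc (s n))) - Finf) powr \<theta> \<le> M * D (s n)"
      using elim by (intro near_cluster) (auto simp: dist_commute)
    also have "\<dots> \<le> real (t n) * D (s n)"
      using elim(4) s_ge(1)[of n] D_pos[of "s n"] by (intro mult_right_mono) auto
    also have "\<dots> < (Fr (x (Suc (s n))) - Finf) powr \<theta>"
      using fails[of "t n"] by (simp add: s_def)
    finally show False by simp
  qed
  then show False by simp
qed

lemma convergence_rate:
  assumes KL: "KL_function (composite f g) \<theta>" and \<theta>: "1 / 2 \<le> \<theta>" "\<theta> < 1"
  obtains xbar \<rho> c where "xbar \<in> stationary_points f g" "x \<longlonglongrightarrow> xbar" "0 < \<rho>" "\<rho> < 1" "0 < c"
    "\<forall>\<^sub>F k in sequentially. norm (x k - xbar) \<le>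
       (if \<theta> = 1 / 2 then c * \<rho> ^ k else c * real k powr ((1 - \<theta>) / (1 - 2 * \<theta>)))"
proof -
  obtain a where a: "0 < a" "\<And>k. a * (D k)\<^sup>2 \<le> Fr (x k) - Fr (x (Suc k))"
    using sufficient_descent by blast
  obtain C where C: "\<forall>\<^sub>F k in sequentially. (Fr (x (Suc k)) - Finf) powr \<theta> \<le> C * D k"
    using kl_error_bound[OF assms] by blast
  have gap: "0 < Fr (x k) - Finf" for k
  proof -
    have "0 < a * (D k)\<^sup>2" using a(1) D_pos[of k] by simp
    then show ?thesis using a(2)[of k] Finf_le[of "Suc k"] by linarith
  qed
  obtain xbar \<rho> c where lim: "x \<longlonglongrightarrow> xbar" and rate: "0 < \<rho>" "\<rho> < 1" "0 < c"
    "\<forall>\<^sub>F k in sequentially. norm (x k - xbar) \<le>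
       (if \<theta> = 1 / 2 then c * \<rho> ^ k else c * real k powr ((1 - \<theta>) / (1 - 2 * \<theta>)))"
  proof (rule kl_descent_rate[OF \<theta> a(1) D_pos gap _ C])
    show "a * (D k)\<^sup>2 \<le> Fr (x k) - Finf - (Fr (x (Suc k)) - Finf)" for k
      using a(2)[of k] by simp
    show "norm (x (Suc k) - x k) \<le> D k" for k
      using step_le by (simp add: D_def)
  qed
  have "xbar \<in> stationary_points f g"
    using cluster_point(6)[OF filterlim_ident lim] .
  then show ?thesis by (rule that[OF _ lim rate])
qed

end

theorem corollary2:
  fixes f g :: "'a::euclidean_space \<Rightarrow> ereal"
    and \<O> :: "'a set"
    and \<mu>l \<beta> \<sigma> \<mu>b \<epsilon> \<theta> :: real
    and \<epsilon>s :: "nat \<Rightarrow> real"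
    and G :: "nat \<Rightarrow> 'a \<Rightarrow>\<^sub>L 'a"
    and x y :: "nat \<Rightarrow> 'a"
  assumes f_proper: "proper_fun f" and g_proper: "proper_fun g"
    and g_lsc: "lsc g" and g_convex: "econvex g" and g_cont: "continuous_on (edom g) g"
    and f_lsc: "lsc f"
    and O_open: "open \<O>" and O_dom: "closure (edom g) \<subseteq> \<O>"
    and f_C2: "twice_cont_diff_on f \<O>"
    and F_bounded_below: "(INF z. composite f g z) > - \<infinity>"
    and vmipg: "vmipg_sequence f g \<mu>l \<beta> \<sigma> \<epsilon>s G x y"
    and x_bounded: "bounded (range x)"
    and \<mu>b_pos: "\<mu>b > 0" and G_bounded: "\<And>k. norm (G k) \<le> \<mu>b"
    and \<epsilon>_pos: "\<epsilon> > 0"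
    and balls_O: "(\<Union>u\<in>stationary_points f g. cball u \<epsilon>) \<subseteq> \<O>"
    and L_less: "(SUP z\<in>(\<Union>u\<in>stationary_points f g. cball u \<epsilon>). lip_modulus (egrad f) z) < ereal \<mu>b"
    and KL: "KL_function (composite f g) \<theta>"
    and \<theta>: "1/2 \<le> \<theta>" "\<theta> < 1"
  shows "\<exists>xbar\<in>stationary_points f g. x \<longlonglongrightarrow> xbar \<and>
    (\<exists>\<rho> c1. 0 < \<rho> \<and> \<rho> < 1 \<and> c1 > 0 \<and>
      (\<forall>\<^sub>F k in sequentially. norm (x k - xbar) \<le>
         (if \<theta> = 1/2 then c1 * \<rho> ^ k
          else c1 * real k powr ((1 - \<theta>) / (1 - 2 * \<theta>)))))"
proof -
  have dom_in_O: "edom g \<subseteq> \<O>"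
    using closure_subset O_dom by blast
  have f_finite: "\<bar>f z\<bar> \<noteq> \<infinity>" if "z \<in> edom g" for z
  proof -
    have "z \<in> \<O>" using dom_in_O that by blast
    then show ?thesis using f_C2 by (simp add: twice_cont_diff_on_def)
  qed
  interpret composite_problem f g
    by unfold_locales (fact g_proper g_convex f_finite)+
  from vmipg have \<mu>l: "0 < \<mu>l" and \<beta>: "0 < \<beta>" "\<beta> < 1" and \<sigma>: "0 < \<sigma>" "\<sigma> < 1 / 2 * min 1 \<mu>l"
    and \<epsilon>s_bounded: "bounded (range \<epsilon>s)"
    and x0: "x 0 \<in> edom g"
    and step: "\<And>k. vmipg_step f g \<mu>l \<beta> \<sigma> (\<epsilon>s k) (G k) (x k) (y k) (x (Suc k))"
    unfolding vmipg_sequence_def by blast+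
  have x_dom: "x k \<in> edom g" for k
  proof (induction k)
    case (Suc k)
    show ?case by (rule vmipg_stepE[OF step Suc \<beta>])
  qed (fact x0)
  obtain \<epsilon>b where \<epsilon>b: "0 < \<epsilon>b" "\<And>k. \<epsilon>s k \<le> \<epsilon>b"
    using \<epsilon>s_bounded unfolding bounded_pos by (force simp: abs_le_iff)
  obtain Fmin where Fmin: "ereal Fmin < (INF z. composite f g z)"
    using ereal_dense2[OF F_bounded_below] by auto
  define iteration where "iteration k z j \<longleftrightarrow>
      z \<in> edom g \<and> y k \<in> edom g \<and> (\<forall>v. \<mu>l * (norm v)\<^sup>2 \<le> v \<bullet> G k v) \<and>
      model (G k) (x k) (y k) < gr (x k) \<and>
      convex_subgradient g z (- (egrad f (x k) + G k (z - x k))) \<and>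
      \<mu>l / 2 * (norm (y k - z))\<^sup>2 \<le> model (G k) (x k) (y k) - model (G k) (x k) z \<and>
      model (G k) (x k) (y k) - model (G k) (x k) z \<le> \<epsilon>b * (norm (y k - x k))\<^sup>2 \<and>
      norm (x (Suc k) - x k) \<le> norm (y k - x k) \<and>
      Fr (x (Suc k)) \<le> Fr (y k) \<and>
      \<sigma> * \<beta> ^ j * (norm (y k - x k))\<^sup>2 \<le> Fr (x k) - Fr (x (Suc k)) \<and>
      (\<forall>i<j. Fr (x k) - Fr (x k + \<beta> ^ i *\<^sub>R (y k - x k)) < \<sigma> * \<beta> ^ i * (norm (y k - x k))\<^sup>2)"
    for k z j
  have "\<exists>z j. iteration k z j" for k
  proof (rule vmipg_stepE[OF step[of k] x_dom \<beta>], goal_cases)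
    case (1 z j)
    have "\<epsilon>s k * (norm (y k - x k))\<^sup>2 \<le> \<epsilon>b * (norm (y k - x k))\<^sup>2"
      using \<epsilon>b(2)[of k] by (intro mult_right_mono) auto
    with 1 show ?case
      unfolding iteration_def by (intro exI[of _ z] exI[of _ j]) auto
  qed
  then obtain xb m where "\<forall>k. iteration k (xb k) (m k)"
    by metis
  note iter = this[unfolded iteration_def]
  interpret inexact_prox_run f g \<O> \<mu>l \<beta> \<sigma> \<mu>b \<epsilon>b Fmin G x y xb m
  proof
    show "Fmin \<le> Fr z" if "z \<in> edom g" for z
    proof -
      have "ereal Fmin \<le> composite f g z"
        using Fmin by (meson INF_lower UNIV_I less_imp_le order_trans)
      then show ?thesis by (simp add: composite_eq[OF that])
    qed
    show "\<sigma> < \<mu>l / 2" using \<sigma>(2) by (simp add: min_def split: if_splits)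
  qed (fact g_lsc g_cont O_open O_dom f_C2 \<mu>l \<beta> \<sigma> \<epsilon>b x_dom x_bounded G_bounded | use iter in blast)+
  obtain xbar \<rho> c where "xbar \<in> stationary_points f g" "x \<longlonglongrightarrow> xbar" "0 < \<rho>" "\<rho> < 1" "0 < c"
    "\<forall>\<^sub>F k in sequentially. norm (x k - xbar) \<le>
       (if \<theta> = 1 / 2 then c * \<rho> ^ k else c * real k powr ((1 - \<theta>) / (1 - 2 * \<theta>)))"
    by (rule convergence_rate[OF KL \<theta>])
  then show ?thesis by blast
qed

end
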